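(* The set $$\widehat{\mathfrak{B}}_{W_0}=\big\{\widehat{x}(z)_{l_m}\cdots\widehat{x}(z)_{l_2}\widehat{x}(z)_{l_1}1\;:\; m\in\mathbb{Z}_{\ge0},\ l_1,\dots,l_m\in\mathbb{Z},\ l_1\le-1,\ l_{r+1}\le l_r-2\text{ for }r=1,\dots,m-1\big\}$$ forms a basis for $W_0$.
   Context: Let $q$ be an indeterminate, $F=\mathbb{C}(q^{1/2})$, $[m]=\frac{q^m-q^{-m}}{q-q^{-1}}$. Let $K(1)=F[a(-1),a(-2),\dots]$ be the polynomial algebra on which $a(-r)$ ($r\ge1$) acts by multiplication and $a(r)$ ($r\ge1$) acts as the derivation with $a(r)\cdot a(-s)=\delta_{rs}\frac{[2r][r]}{r}$. Let $Q=\mathbb{Z}\alpha$, $(\alpha,\alpha)=2$; $F\{Q\}$ is the group algebra with basis $e^\beta$; $L_0=K(1)\otimes F\{Q\}$; $z^{\partial_\alpha}e^\beta=z^{(\alpha,\beta)}e^\beta$. Define on $L_0$ $$x^+(z)=\exp\Big(\sum_{r\ge1}\tfrac{q^{-r/2}}{[r]}a(-r)z^r\Big)\exp\Big(-\sum_{r\ge1}\tfrac{q^{-r/2}}{[r]}a(r)z^{-r}\Big)\otimes e^\alpha z^{\partial_\alpha},$$ $$\widehat{k}(z)=\exp\Big((q-q^{-1})\sum_{r\ge1}\tfrac{-q^{r/2}}{1+q^{2r}}a(r)z^{-r}\Big),\qquad \widehat{x}(z)=x^+(z)\widehat{k}(z)\in\mathrm{Hom}(L_0,L_0((z))).$$ The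 operators satisfy $[\widehat{x}(z_1),\widehat{x}(z_2)]=0$. $W_0\subset\mathrm{Hom}(L_0,L_0((z)))$ is the vertex algebra generated by $\widehat{x}(z)$, with vacuum the identity $1$ and $Y(a(z),z_0)b(z)=\sum_r a(z)_rb(z)z_0^{-r-1}=a(z+z_0)b(z)$; concretely, it is the smallest $F$-subspace containing $1$ and $\widehat{x}(z)$ and closed under the products $a(z)_rb(z)=0$ for $r\ge0$ and $a(z)_rb(z)=\frac{1}{(-r-1)!}a^{(-r-1)}(z)b(z)$ for $r<0$, where $a^{(n)}(z)=\frac{d^n}{dz^n}a(z)$. Iterated products are nested to the right. *)

theory Defs
  imports
    "HOL-Library.Poly_Mapping"
    "HOL-Library.Function_Algebras"
    "HOL-Computational_Algebra.Computational_Algebra"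
begin

section \<open>The ground field and the space \<open>L\<^sub>0\<close>\<close>

text \<open>
  \<open>F = \<complex>(q\<^bsup>1/2\<^esup>)\<close> is the field of fractions of \<open>\<complex>[q\<^bsup>1/2\<^esup>]\<close>.  In \<open>K1\<close>, the polynomial variable with
  index \<open>i\<close> is \<open>a(-(i+1))\<close>, so that there is no variable \<open>a(0)\<close>.  \<open>L\<^sub>0 = K(1) \<otimes> F{Q}\<close> is the group
  algebra of \<open>Q = \<int>\<alpha>\<close> with coefficients in \<open>K(1)\<close>: \<open>Poly_Mapping.single n p\<close> is \<open>p \<otimes> e\<^bsup>n\<alpha>\<^esup>\<close>.
\<close>

type_synonym F = "complex poly fract"
type_synonym K1 = "(nat \<Rightarrow>\<^sub>0 nat) \<Rightarrow>\<^sub>0 F"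
type_synonym L0 = "int \<Rightarrow>\<^sub>0 K1"

definition qh :: F  \<comment> \<open>\<open>q\<^bsup>1/2\<^esup>\<close>\<close>
  where "qh = Fract [:0, 1:] 1"

definition q :: F
  where "q = qh ^ 2"

definition qint :: "nat \<Rightarrow> F"
  where "qint m = (q ^ m - inverse q ^ m) / (q - inverse q)"

definition scaleL :: "F \<Rightarrow> L0 \<Rightarrow> L0"
  where "scaleL c v = Poly_Mapping.single 0 (Poly_Mapping.single 0 c) * v"

definition avar :: "nat \<Rightarrow> K1"  \<comment> \<open>the element \<open>a(-r)\<close> for \<open>r \<ge> 1\<close>\<close>
  where "avar r = Poly_Mapping.single (Poly_Mapping.single (r - 1) 1) 1"

definition a_neg :: "nat \<Rightarrow> L0 \<Rightarrow> L0"  \<comment> \<open>the operator \<open>a(-r)\<close> for \<open>r \<ge> 1\<close>\<close>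
  where "a_neg r v = Poly_Mapping.single 0 (avar r) * v"

definition pdiff :: "nat \<Rightarrow> K1 \<Rightarrow> K1"  \<comment> \<open>the partial derivative in the variable of index \<open>i\<close>\<close>
  where "pdiff i p = (\<Sum>m\<in>Poly_Mapping.keys p.
    Poly_Mapping.single (m - Poly_Mapping.single i 1)
      (of_nat (Poly_Mapping.lookup m i) * Poly_Mapping.lookup p m))"

definition aK_pos :: "nat \<Rightarrow> K1 \<Rightarrow> K1"  \<comment> \<open>the derivation \<open>a(r)\<close> of \<open>K(1)\<close> for \<open>r \<ge> 1\<close>\<close>
  where "aK_pos r p =
    Poly_Mapping.single 0 (qint (2 * r) * qint r / of_nat r) * pdiff (r - 1) p"

definition a_pos :: "nat \<Rightarrow> L0 \<Rightarrow> L0"  \<comment> \<open>the operator \<open>a(r) \<otimes> 1\<close> for \<open>r \<ge> 1\<close>\<close>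
  where "a_pos r v = Poly_Mapping.map (aK_pos r) v"

text \<open>\<open>aK_pos r\<close> is the \<open>F\<close>-linear derivation determined by its values on the variables:\<close>

lemma lookup_pdiff:
  "Poly_Mapping.lookup (pdiff i p) m =
    of_nat (Poly_Mapping.lookup m i + 1) * Poly_Mapping.lookup p (m + Poly_Mapping.single i 1)"
proof -
  let ?e = "Poly_Mapping.single i (1::nat)"
  let ?f = "\<lambda>m'. of_nat (Poly_Mapping.lookup m' i) * Poly_Mapping.lookup p m'"
  have eq: "(?f m' when m' - ?e = m) = (if m' = m + ?e then ?f (m + ?e) else 0)" for m'
  proof (cases "Poly_Mapping.lookup m' i = 0")
    case True
    then have "m' \<noteq> m + ?e" by (auto simp: lookup_add)
    then show ?thesis using True by (simp add: when_def)
  next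
    case False
    then have "m' - ?e + ?e = m'"
      by (intro poly_mapping_eqI) (auto simp: lookup_add lookup_minus lookup_single when_def)
    then have "m' - ?e = m \<longleftrightarrow> m' = m + ?e" by auto
    then show ?thesis by (simp add: when_def)
  qed
  have "Poly_Mapping.lookup (pdiff i p) m = (\<Sum>m'\<in>Poly_Mapping.keys p. ?f m' when m' - ?e = m)"
    by (simp add: pdiff_def lookup_sum lookup_single)
  also have "\<dots> = (\<Sum>m'\<in>Poly_Mapping.keys p. if m' = m + ?e then ?f (m + ?e) else 0)"
    by (simp only: eq)
  also have "\<dots> = ?f (m + ?e)"
    by (simp add: sum.delta in_keys_iff)
  finally show ?thesis by (simp add: lookup_add)
qed

lemma pdiff_0 [simp]: "pdiff i 0 = 0"
  by (simp add: pdiff_def)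

lemma pdiff_add: "pdiff i (p + p') = pdiff i p + pdiff i p'"
  by (rule poly_mapping_eqI) (simp add: lookup_pdiff lookup_add algebra_simps)

lemma pdiff_single:
  "pdiff i (Poly_Mapping.single m c) =
    Poly_Mapping.single (m - Poly_Mapping.single i 1) (of_nat (Poly_Mapping.lookup m i) * c)"
  by (simp add: pdiff_def)

lemma pdiff_mult_single:
  "pdiff i (Poly_Mapping.single m c * Poly_Mapping.single m' c') =
    pdiff i (Poly_Mapping.single m c) * Poly_Mapping.single m' c' +
    Poly_Mapping.single m c * pdiff i (Poly_Mapping.single m' c')"
proof -
  let ?e = "Poly_Mapping.single i (1::nat)"
  have shift: "m - ?e + m' = m + m' - ?e" if "Poly_Mapping.lookup m i \<noteq> 0" for m m' :: "nat \<Rightarrow>\<^sub>0 nat"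
    using that
    by (intro poly_mapping_eqI) (auto simp: lookup_add lookup_minus lookup_single when_def)
  have l: "Poly_Mapping.single (m - ?e + m') (of_nat (Poly_Mapping.lookup m i) * (c * c')) =
      Poly_Mapping.single (m + m' - ?e) (of_nat (Poly_Mapping.lookup m i) * (c * c'))"
    using shift[of m m'] by (cases "Poly_Mapping.lookup m i = 0") simp_all
  have r: "Poly_Mapping.single (m + (m' - ?e)) (of_nat (Poly_Mapping.lookup m' i) * (c * c')) =
      Poly_Mapping.single (m + m' - ?e) (of_nat (Poly_Mapping.lookup m' i) * (c * c'))"
    using shift[of m' m] by (cases "Poly_Mapping.lookup m' i = 0") (simp_all add: add.commute)
  show ?thesis
    using l r
    by (simp add: pdiff_single mult_single lookup_add algebra_simps flip: single_add)
qed

lemma poly_mapping_add_induct: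
  fixes p :: "'a \<Rightarrow>\<^sub>0 'b::comm_monoid_add"
  assumes "P 0" "\<And>p m c. P p \<Longrightarrow> P (p + Poly_Mapping.single m c)"
  shows "P p"
proof (induction p rule: update_induct)
  case const
  show ?case by (rule assms(1))
next
  case (update f a b)
  then have "Poly_Mapping.update a b f = f + Poly_Mapping.single a b"
    by (intro poly_mapping_eqI)
       (auto simp: lookup_update lookup_add lookup_single when_def in_keys_iff)
  then show ?case using update assms(2) by simp
qed

lemma pdiff_mult: "pdiff i (p * p') = pdiff i p * p' + p * pdiff i p'"
proof (induction p rule: poly_mapping_add_induct)
  case 1
  show ?case by simp
next
  case (2 p m c)
  have "pdiff i (Poly_Mapping.single m c * p') =
      pdiff i (Poly_Mapping.single m c) * p' + Poly_Mapping.single m c * pdiff i p'"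
    by (induction p' rule: poly_mapping_add_induct)
       (simp_all add: pdiff_add pdiff_mult_single algebra_simps)
  then show ?case using 2 by (simp add: pdiff_add algebra_simps)
qed

lemma aK_pos_add: "aK_pos r (p + p') = aK_pos r p + aK_pos r p'"
  by (simp add: aK_pos_def pdiff_add algebra_simps)

lemma aK_pos_mult: "aK_pos r (p * p') = aK_pos r p * p' + p * aK_pos r p'"
  by (simp add: aK_pos_def pdiff_mult algebra_simps)

lemma aK_pos_const: "aK_pos r (Poly_Mapping.single 0 c) = 0"
  by (simp add: aK_pos_def pdiff_single)

lemma aK_pos_avar:
  assumes "r \<ge> 1" "s \<ge> 1"
  shows "aK_pos r (avar s) =
    (if r = s then Poly_Mapping.single 0 (qint (2 * r) * qint r / of_nat r) else 0)"
  using assms by (auto simp: aK_pos_def avar_def pdiff_single mult_single lookup_single when_def)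


section \<open>Operators in \<open>Hom(L\<^sub>0, L\<^sub>0((z)))\<close>\<close>

text \<open>
  An element of \<open>Hom(L\<^sub>0, L\<^sub>0((z)))\<close> is represented by a function \<open>L0 \<Rightarrow> L0 fls\<close>; the coefficient of
  \<open>z\<^sup>n\<close> in \<open>a(z)v\<close> is \<open>a v $$ n\<close>.
\<close>

type_synonym oper = "L0 \<Rightarrow> L0 fls"

notation fls_nth (infixl \<open>$$\<close> 75)

definition scaleH :: "F \<Rightarrow> oper \<Rightarrow> oper"
  where "scaleH c a = (\<lambda>v. fls_const (Poly_Mapping.single 0 (Poly_Mapping.single 0 c)) * a v)"

lemma scaleH_nth: "scaleH c a v $$ n = scaleL c (a v $$ n)"
  by (simp add: scaleH_def scaleL_def)

global_interpretation hom: vector_space scaleH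
proof
  fix c d :: F and a b :: oper
  show "scaleH c (a + b) = scaleH c a + scaleH c b"
    by (simp add: scaleH_def fun_eq_iff algebra_simps)
  show "scaleH (c + d) a = scaleH c a + scaleH d a"
    by (simp add: scaleH_def fun_eq_iff single_add fls_plus_const distrib_right flip: fls_plus_const)
  show "scaleH c (scaleH d a) = scaleH (c * d) a"
    by (simp add: scaleH_def fun_eq_iff mult_single fls_const_mult_const flip: mult.assoc)
  show "scaleH 1 a = a"
    by (simp add: scaleH_def)
qed

definition vac :: oper
  where "vac v = fls_const v"

definition oderiv :: "oper \<Rightarrow> oper"
  where "oderiv a v = fls_deriv (a v)"

text \<open>
  The product \<open>a(z)b(z)\<close>: the coefficient of \<open>z\<^sup>n\<close> in \<open>a(z)b(z)v\<close> is the sum over all \<open>j\<close> of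
  \<open>a\<^bsub>n-j\<^esub>(b\<^sub>j v)\<close>, where \<open>a\<^sub>i\<close> and \<open>b\<^sub>i\<close> are the coefficients of \<open>z\<^sup>i\<close>.  It is meaningful for pairs
  for which this sum has finitely many non-zero terms and vanishes for \<open>n\<close> sufficiently negative,
  for instance if \<open>a(z\<^sub>1)b(z\<^sub>2)v\<close> lies in \<open>L\<^sub>0((z\<^sub>1, z\<^sub>2))\<close> for all \<open>v\<close> (as for \<open>a\<close>, \<open>b\<close> in \<open>W\<^sub>0\<close>), or if
  \<open>b(z)v\<close> is always a Laurent polynomial (as for the factors of \<open>x_hat\<close>), see \<open>omult_nth\<close>.
\<close>

definition omult :: "oper \<Rightarrow> oper \<Rightarrow> oper"
  where "omult a b v = Abs_fls (\<lambda>n. Sum_any (\<lambda>j. a (b v $$ j) $$ (n - j)))"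

lemma omult_nth:
  assumes fin: "finite {j. b v $$ j \<noteq> 0}" and a0: "a 0 = 0"
  shows "omult a b v $$ n = (\<Sum>j | b v $$ j \<noteq> 0. a (b v $$ j) $$ (n - j))"
proof -
  let ?J = "{j. b v $$ j \<noteq> 0}"
  have eq: "Sum_any (\<lambda>j. a (b v $$ j) $$ (n - j)) = (\<Sum>j\<in>?J. a (b v $$ j) $$ (n - j))" for n
    by (rule Sum_any.expand_superset[OF fin]) (auto simp: a0)
  have "\<exists>N. \<forall>n<N. \<forall>j\<in>?J. a (b v $$ j) $$ (n - j) = 0"
    using fin
  proof induction
    case (insert i J)
    then obtain N where N: "\<forall>n<N. \<forall>j\<in>J. a (b v $$ j) $$ (n - j) = 0" by blast
    obtain M where M: "\<forall>n<M. a (b v $$ i) $$ n = 0" by (elim fls_nth_vanishes_belowE)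
    show ?case by (rule exI[of _ "min N (M + i)"]) (use N M in auto)
  qed auto
  then obtain N where "\<forall>n<N. \<forall>j\<in>?J. a (b v $$ j) $$ (n - j) = 0" by blast
  then have "\<forall>n<N. (\<Sum>j\<in>?J. a (b v $$ j) $$ (n - j)) = 0" by simp
  then show ?thesis
    unfolding omult_def eq by (rule nth_Abs_fls_lower_bound)
qed

text \<open>\<open>coeff_pow A n k\<close> and \<open>coeff_exp A k\<close> are the coefficients of \<open>w\<^sup>k\<close> in the \<open>n\<close>-th power and in
  the exponential of the operator series \<open>\<Sum>\<^bsub>r \<ge> 1\<^esub> A r w\<^sup>r\<close>; the \<open>n\<close>-th power contributes nothing
  to the coefficient of \<open>w\<^sup>k\<close> if \<open>n > k\<close>.\<close>

primrec coeff_pow :: "(nat \<Rightarrow> L0 \<Rightarrow> L0) \<Rightarrow> nat \<Rightarrow> nat \<Rightarrow> L0 \<Rightarrow> L0" where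
  "coeff_pow A 0 k v = (if k = 0 then v else 0)"
| "coeff_pow A (Suc n) k v = (\<Sum>r = 1..k. A r (coeff_pow A n (k - r) v))"

definition coeff_exp :: "(nat \<Rightarrow> L0 \<Rightarrow> L0) \<Rightarrow> nat \<Rightarrow> L0 \<Rightarrow> L0"
  where "coeff_exp A k v = (\<Sum>n\<le>k. scaleL (1 / of_nat (fact n)) (coeff_pow A n k v))"

definition exp_z :: "(nat \<Rightarrow> L0 \<Rightarrow> L0) \<Rightarrow> oper"  \<comment> \<open>\<open>exp(\<Sum>\<^bsub>r \<ge> 1\<^esub> A r z\<^sup>r)\<close>\<close>
  where "exp_z A v = fps_to_fls (Abs_fps (\<lambda>k. coeff_exp A k v))"

text \<open>\<open>exp(\<Sum>\<^bsub>r \<ge> 1\<^esub> A r z\<^bsup>-r\<^esup>)\<close>, for families \<open>A\<close> such that \<open>coeff_exp A k v\<close> vanishes for all large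
  \<open>k\<close>; this is so if each \<open>A r\<close> is a multiple of \<open>a(r)\<close>, see \<open>exp_zinv_a_pos_nth\<close> below.\<close>

definition exp_zinv :: "(nat \<Rightarrow> L0 \<Rightarrow> L0) \<Rightarrow> oper"
  where "exp_zinv A v = Abs_fls (\<lambda>n. if n \<le> 0 then coeff_exp A (nat (- n)) v else 0)"

lemma lookup_scaleL:
  "Poly_Mapping.lookup (scaleL c v) n = Poly_Mapping.single 0 c * Poly_Mapping.lookup v n"
proof -
  have "scaleL c v = Poly_Mapping.map ((*) (Poly_Mapping.single 0 c)) v"
    unfolding scaleL_def by (rule mult_map_scale_conv_mult[symmetric])
  then show ?thesis by (auto simp: Poly_Mapping.map.rep_eq when_def)
qed

lemma lookup_single_0_mult:
  "Poly_Mapping.lookup (Poly_Mapping.single 0 c * (p :: K1)) m = c * Poly_Mapping.lookup p m"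
  unfolding mult_map_scale_conv_mult[symmetric]
  by (simp add: Poly_Mapping.map.rep_eq when_def)

lemma lookup_a_pos: "Poly_Mapping.lookup (a_pos r v) n = aK_pos r (Poly_Mapping.lookup v n)"
  by (simp add: a_pos_def Poly_Mapping.map.rep_eq when_def aK_pos_def)

definition wt :: "(nat \<Rightarrow>\<^sub>0 nat) \<Rightarrow> int"  \<comment> \<open>the weight for which \<open>a(-r)\<close> has weight \<open>r\<close>\<close>
  where "wt m = (\<Sum>i\<in>Poly_Mapping.keys m. int (i + 1) * int (Poly_Mapping.lookup m i))"

definition wt_le :: "int \<Rightarrow> L0 \<Rightarrow> bool"
  where "wt_le N v \<longleftrightarrow>
    (\<forall>n m. Poly_Mapping.lookup (Poly_Mapping.lookup v n) m \<noteq> 0 \<longrightarrow> wt m \<le> N)"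

lemma wt_nonneg: "wt m \<ge> 0"
  by (simp add: wt_def sum_nonneg)

lemma wt_add_single: "wt (m + Poly_Mapping.single i 1) = wt m + int (i + 1)"
proof -
  have "wt (m + Poly_Mapping.single i 1) = wt m + wt (Poly_Mapping.single i 1)"
    unfolding wt_def by (rule setsum_keys_plus_distrib) (simp_all add: algebra_simps)
  then show ?thesis by (simp add: wt_def)
qed

lemma wt_le_negative:
  assumes "wt_le N v" "N < 0"
  shows "v = 0"
proof (rule poly_mapping_eqI)+
  fix n m
  show "Poly_Mapping.lookup (Poly_Mapping.lookup v n) m =
      Poly_Mapping.lookup (Poly_Mapping.lookup 0 n) m"
    using assms wt_nonneg[of m] by (force simp: wt_le_def)
qed

lemma wt_le_ex: "\<exists>N. wt_le N v"
proof -
  let ?S = "\<Union>n\<in>Poly_Mapping.keys v. Poly_Mapping.keys (Poly_Mapping.lookup v n)"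
  have "wt m \<le> (\<Sum>m\<in>?S. wt m)" if "Poly_Mapping.lookup (Poly_Mapping.lookup v n) m \<noteq> 0" for n m
  proof -
    from that have "m \<in> ?S" by (auto simp: in_keys_iff intro!: bexI[of _ n])
    then show ?thesis by (intro member_le_sum) (auto simp: wt_nonneg)
  qed
  then show ?thesis unfolding wt_le_def by blast
qed

lemma wt_le_scaleL: "wt_le N v \<Longrightarrow> wt_le N (scaleL c v)"
  by (auto simp: wt_le_def lookup_scaleL lookup_single_0_mult)

lemma wt_le_sum: "(\<And>i. i \<in> I \<Longrightarrow> wt_le N (f i)) \<Longrightarrow> wt_le N (sum f I)"
  unfolding wt_le_def lookup_sum by (metis (no_types, lifting) sum.neutral)

lemma wt_le_a_pos: "wt_le N v \<Longrightarrow> r \<ge> 1 \<Longrightarrow> wt_le (N - int r) (a_pos r v)"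
  unfolding wt_le_def
proof (intro allI impI)
  fix n m
  assume *: "\<forall>n m. Poly_Mapping.lookup (Poly_Mapping.lookup v n) m \<noteq> 0 \<longrightarrow> wt m \<le> N"
    and "r \<ge> 1" and "Poly_Mapping.lookup (Poly_Mapping.lookup (a_pos r v) n) m \<noteq> 0"
  then have "Poly_Mapping.lookup (Poly_Mapping.lookup v n) (m + Poly_Mapping.single (r - 1) 1) \<noteq> 0"
    by (auto simp: lookup_a_pos aK_pos_def lookup_single_0_mult lookup_pdiff)
  with * have "wt (m + Poly_Mapping.single (r - 1) 1) \<le> N" by blast
  then show "wt m \<le> N - int r" using \<open>r \<ge> 1\<close> unfolding wt_add_single by simp
qed

lemma wt_le_coeff_pow_a_pos:
  "wt_le N v \<Longrightarrow> wt_le (N - int k) (coeff_pow (\<lambda>r v. scaleL (c r) (a_pos r v)) n k v)"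
proof (induction n arbitrary: k)
  case 0
  then show ?case by (simp add: wt_le_def)
next
  case (Suc n)
  have "wt_le (N - int k)
      (scaleL (c r) (a_pos r (coeff_pow (\<lambda>r v. scaleL (c r) (a_pos r v)) n (k - r) v)))"
    if "r \<in> {1..k}" for r
    using wt_le_a_pos[OF Suc.IH[OF Suc.prems, of "k - r"], of r] that
    by (intro wt_le_scaleL) (simp add: of_nat_diff)
  then show ?case unfolding coeff_pow.simps by (rule wt_le_sum)
qed

lemma coeff_exp_a_pos_eventually_0:
  "\<exists>N. \<forall>k>N. coeff_exp (\<lambda>r v. scaleL (c r) (a_pos r v)) k v = 0"
proof -
  obtain N where N: "wt_le N v" using wt_le_ex by blast
  have "coeff_exp (\<lambda>r v. scaleL (c r) (a_pos r v)) k v = 0" if "k > nat N" for k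
  proof (rule wt_le_negative)
    show "wt_le (N - int k) (coeff_exp (\<lambda>r v. scaleL (c r) (a_pos r v)) k v)"
      unfolding coeff_exp_def by (intro wt_le_sum wt_le_scaleL wt_le_coeff_pow_a_pos N)
    show "N - int k < 0" using that by linarith
  qed
  then show ?thesis by blast
qed

lemma exp_zinv_a_pos_nth:
  "exp_zinv (\<lambda>r v. scaleL (c r) (a_pos r v)) v $$ n =
    (if n \<le> 0 then coeff_exp (\<lambda>r v. scaleL (c r) (a_pos r v)) (nat (- n)) v else 0)"
proof -
  obtain N where N: "\<And>k. k > N \<Longrightarrow> coeff_exp (\<lambda>r v. scaleL (c r) (a_pos r v)) k v = 0"
    using coeff_exp_a_pos_eventually_0 by blast
  show ?thesis
    unfolding exp_zinv_def
    by (rule nth_Abs_fls_lower_bound[where N = "- int N"]) (auto intro!: N)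
qed

text \<open>\<open>e\<^sup>\<alpha>z\<^bsup>\<partial>\<^sub>\<alpha>\<^esup>\<close> sends \<open>p \<otimes> e\<^bsup>n\<alpha>\<^esup>\<close> to \<open>p \<otimes> e\<^bsup>(n+1)\<alpha>\<^esup> z\<^bsup>2n\<^esup>\<close>, as \<open>(\<alpha>, n\<alpha>) = 2n\<close>.\<close>

definition e_alpha_z :: oper
  where "e_alpha_z v = (\<Sum>n\<in>Poly_Mapping.keys v.
    fls_const (Poly_Mapping.single 1 1 * Poly_Mapping.single n (Poly_Mapping.lookup v n))
      * fls_X_intpow (2 * n))"

definition x_plus :: oper
  where "x_plus =
    omult
      (omult
        (exp_z (\<lambda>r v. scaleL (inverse qh ^ r / qint r) (a_neg r v)))
        (exp_zinv (\<lambda>r v. scaleL (- (inverse qh ^ r / qint r)) (a_pos r v))))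
      e_alpha_z"

definition k_hat :: oper
  where "k_hat =
    exp_zinv (\<lambda>r v. scaleL ((q - inverse q) * (- (qh ^ r) / (1 + q ^ (2 * r)))) (a_pos r v))"

definition x_hat :: oper
  where "x_hat = omult x_plus k_hat"


section \<open>The vertex algebra \<open>W\<^sub>0\<close>\<close>

definition nprod :: "oper \<Rightarrow> int \<Rightarrow> oper \<Rightarrow> oper"  \<comment> \<open>\<open>a(z)\<^sub>r b(z)\<close>\<close>
  where "nprod a r b =
    (if r \<ge> 0 then 0
     else scaleH (1 / of_nat (fact (nat (- r - 1)))) (omult ((oderiv ^^ nat (- r - 1)) a) b))"

inductive_set W0 :: "oper set" where
  vac: "vac \<in> W0"
| x_hat: "x_hat \<in> W0"
| add: "a \<in> W0 \<Longrightarrow> b \<in> W0 \<Longrightarrow> a + b \<in> W0"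
| scale: "a \<in> W0 \<Longrightarrow> scaleH c a \<in> W0"
| nprod: "a \<in> W0 \<Longrightarrow> b \<in> W0 \<Longrightarrow> nprod a r b \<in> W0"

lemma W0_smallest:
  "W0 = \<Inter>{S. hom.subspace S \<and> vac \<in> S \<and> x_hat \<in> S \<and> (\<forall>a\<in>S. \<forall>b\<in>S. \<forall>r. nprod a r b \<in> S)}"
proof -
  have "hom.subspace W0"
    unfolding hom.subspace_def
    using W0.add W0.scale W0.scale[OF W0.vac, of 0] by auto
  moreover have "W0 \<subseteq> S"
    if "hom.subspace S" "vac \<in> S" "x_hat \<in> S" "\<forall>a\<in>S. \<forall>b\<in>S. \<forall>r. nprod a r b \<in> S" for S
  proof
    fix a assume "a \<in> W0"
    then show "a \<in> S"
    proof induction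
      case (add a b)
      show ?case by (rule hom.subspace_add[OF that(1) add.IH])
    next
      case (scale a c)
      show ?case by (rule hom.subspace_scale[OF that(1) scale.IH])
    qed (use that in simp_all)
  qed
  ultimately show ?thesis
    using W0.vac W0.x_hat W0.nprod by (intro equalityI Inter_greatest Inter_lower CollectI) auto
qed

text \<open>\<open>monomial [l\<^sub>1, \<dots>, l\<^sub>m]\<close> is \<open>x_hat\<^bsub>l\<^sub>m\<^esub> \<dots> x_hat\<^bsub>l\<^sub>1\<^esub> 1\<close>: the head of the list acts first.\<close>

definition monomial :: "int list \<Rightarrow> oper"
  where "monomial ls = fold (nprod x_hat) ls vac"

definition admissible :: "int list \<Rightarrow> bool"
  where "admissible ls \<longleftrightarrow>
    (ls \<noteq> [] \<longrightarrow> ls ! 0 \<le> -1) \<and> (\<forall>r. r + 1 < length ls \<longrightarrow> ls ! (r + 1) \<le> ls ! r - 2)"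

definition B_W0 :: "oper set"
  where "B_W0 = {monomial ls | ls. admissible ls}"

end

theory Submission
  imports Defs
begin

text \<open>
  The total contraction of \<open>x_hat(z\<^sub>1)\<close> with \<open>x_hat(z\<^sub>2)\<close> is \<open>(z\<^sub>1 - z\<^sub>2)\<^sup>2\<close>. Hence the modes of \<open>x_hat\<close> commute and
  \<open>x_hat(z)\<^sup>2 = 0\<close>, so \<open>W\<^sub>0\<close> is a commutative differential algebra generated by the divided powers
  \<open>y\<^sub>n = x_hat\<^bsup>(n)\<^esup>(z)/n!\<close>, with \<open>\<Sum>\<^bsub>i+j=n\<^esub> y\<^sub>i y\<^sub>j = 0\<close>. These relations rewrite \<open>y\<^sub>i\<^sup>2\<close> and \<open>y\<^sub>i y\<^bsub>i+1\<^esub>\<close> through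
  monomials with a larger sum of squares of indices, which gives the spanning part.

  For independence, the constant term in \<open>z\<close> of the image of \<open>1 \<in> L\<^sub>0\<close> sends \<open>y\<^bsub>n\<^sub>1\<^esub> \<cdots> y\<^bsub>n\<^sub>m\<^esub>\<close> to
  \<open>X\<^bsub>n\<^sub>1\<^esub> \<cdots> X\<^bsub>n\<^sub>m\<^esub> 1\<close>, where \<open>x_hat(z) = \<Sum> X\<^sub>k z\<^sup>k\<close>. Taking the annihilation part of \<open>x_hat\<close> with halved
  exponents yields an operator that lowers all indices of such a vector of length \<open>m\<close> by one, and kills it if some
  index is \<open>0\<close>; on the other hand \<open>X\<^sub>0 1 = e\<^sup>\<alpha>\<close> and \<open>X\<^sub>k e\<^sup>\<alpha> = e\<^sup>\<alpha> X\<^bsub>k-2\<^esub>\<close> shorten a vector with an index \<open>0\<close>.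
  Induction on \<open>m\<close> and on the smallest index concludes.
\<close>

section \<open>The commutative ring \<open>L\<^sub>0\<close>\<close>

text \<open>Characteristic 0 of \<open>F\<close> gives meaning to \<open>1 / fact n\<close> and lets
  positive integers be cancelled, as the recursions for coefficients of exponentials
  require.\<close>

instance fract :: ("{idom, ring_char_0}") field_char_0
proof
  show "inj (of_nat :: nat \<Rightarrow> 'a fract)"
    by (rule injI) (simp add: eq_fract flip: Fract_of_nat_eq)
qed

definition cst :: "F \<Rightarrow> L0"
  where "cst c = Poly_Mapping.single 0 (Poly_Mapping.single 0 c)"

definition Avar :: "nat \<Rightarrow> L0"
  where "Avar r = Poly_Mapping.single 0 (avar r)"

definition evec :: "int \<Rightarrow> L0"
  where "evec n = Poly_Mapping.single n 1"

lemma scaleL_cst: "scaleL c v = cst c * v"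
  by (simp add: scaleL_def cst_def)

lemma a_neg_Avar: "a_neg r v = Avar r * v"
  by (simp add: a_neg_def Avar_def)

lemma cst_0 [simp]: "cst 0 = 0" and cst_1 [simp]: "cst 1 = 1"
  and cst_add: "cst (c + d) = cst c + cst d"
  and cst_mult: "cst (c * d) = cst c * cst d"
  and cst_uminus: "cst (- c) = - cst c"
  by (simp_all add: cst_def single_add mult_single single_uminus)

lemma cst_of_nat: "cst (of_nat n) = of_nat n"
  by (induction n) (simp_all add: cst_add)

lemma cst_of_int: "cst (of_int n) = of_int n"
  by (cases n rule: int_cases2) (simp_all add: cst_of_nat cst_uminus)

lemma cst_numeral: "cst (numeral n) = numeral n"
  using cst_of_nat[of "numeral n"] by simp

lemma cst_cancel: "cst c * u = cst c * v \<Longrightarrow> c \<noteq> 0 \<Longrightarrow> u = v"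
proof -
  assume eq: "cst c * u = cst c * v" and "c \<noteq> 0"
  then have "cst (inverse c) * cst c = 1" by (simp flip: cst_mult)
  then show "u = v" using arg_cong[OF eq, of "\<lambda>w. cst (inverse c) * w"]
    by (simp flip: mult.assoc)
qed

lemma evec_0 [simp]: "evec 0 = 1"
  by (simp add: evec_def)

lemma evec_mult: "evec m * evec n = evec (m + n)"
  by (simp add: evec_def mult_single)

lemma lookup_0_mult:
  "Poly_Mapping.lookup (Poly_Mapping.single 0 p * (v :: L0)) n = p * Poly_Mapping.lookup v n"
  unfolding mult_map_scale_conv_mult[symmetric]
  by (simp add: Poly_Mapping.map.rep_eq when_def)

text \<open>Scheme for identities between linear operators: check them on the
  \<open>e^(n alpha)\<close>, which all annihilation operators kill, then commute with each
  \<open>a(-r)\<close>.\<close>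

lemma L0_induct:
  assumes add: "\<And>u v. P u \<Longrightarrow> P v \<Longrightarrow> P (u + v)"
    and cst: "\<And>c v. P v \<Longrightarrow> P (cst c * v)"
    and evec: "\<And>n. P (evec n)"
    and Avar: "\<And>r v. r \<ge> 1 \<Longrightarrow> P v \<Longrightarrow> P (Avar r * v)"
  shows "P v"
proof -
  have P0: "P 0" using cst[OF evec, of 0] by simp
  have Apow: "P (Avar r ^ k * v)" if "P v" "r \<ge> 1" for r k v
    by (induction k) (use that Avar in \<open>simp_all add: mult.assoc\<close>)
  have Apow_eq: "Avar (Suc i) ^ k = Poly_Mapping.single 0 (Poly_Mapping.single (Poly_Mapping.single i k) 1)" for i k
    by (induction k) (simp_all add: Avar_def avar_def mult_single flip: single_add)
  have mono: "P (Poly_Mapping.single n (Poly_Mapping.single m 1))" for n m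
  proof (induction m rule: poly_mapping_add_induct)
    case 1
    then show ?case using evec[of n] by (simp add: evec_def)
  next
    case (2 m i k)
    have "Avar (Suc i) ^ k * Poly_Mapping.single n (Poly_Mapping.single m 1) =
        Poly_Mapping.single n (Poly_Mapping.single (m + Poly_Mapping.single i k) 1)"
      by (simp add: Apow_eq mult_single add.commute)
    then show ?case using Apow[OF 2, of "Suc i" k] by simp
  qed
  have inner: "P (Poly_Mapping.single n p)" for n p
  proof (induction p rule: poly_mapping_add_induct)
    case 1
    then show ?case using P0 by simp
  next
    case (2 p m c)
    have "P (Poly_Mapping.single n (Poly_Mapping.single m c))"
      using cst[OF mono[of n m], of c] by (simp add: cst_def mult_single)
    then show ?case using 2 add by (simp add: single_add)
  qed
  show ?thesis
    by (induction v rule: poly_mapping_add_induct) (simp_all add: P0 add inner)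
qed

definition linL :: "(L0 \<Rightarrow> L0) \<Rightarrow> bool"
  where "linL f \<longleftrightarrow> (\<forall>u v. f (u + v) = f u + f v) \<and> (\<forall>c v. f (cst c * v) = cst c * f v)"

lemma linL_add: "linL f \<Longrightarrow> f (u + v) = f u + f v"
  and linL_cst: "linL f \<Longrightarrow> f (cst c * v) = cst c * f v"
  by (simp_all add: linL_def)

lemma linL_0: "linL f \<Longrightarrow> f 0 = 0"
  using linL_cst[of f 0 0] by simp

lemma linL_uminus: "linL f \<Longrightarrow> f (- v) = - f v"
  using linL_cst[of f "-1" v] by (simp add: cst_uminus)

lemma linL_diff: "linL f \<Longrightarrow> f (u - v) = f u - f v"
  using linL_add[of f u "- v"] by (simp add: linL_uminus)

lemma linL_of_nat: "linL f \<Longrightarrow> f (of_nat n * v) = of_nat n * f v"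
  using linL_cst[of f "of_nat n" v] by (simp add: cst_of_nat)

lemma linL_of_int: "linL f \<Longrightarrow> f (of_int n * v) = of_int n * f v"
  using linL_cst[of f "of_int n" v] by (simp add: cst_of_int)

lemma linL_sum: "linL f \<Longrightarrow> f (sum g I) = (\<Sum>i\<in>I. f (g i))"
  by (induction I rule: infinite_finite_induct) (simp_all add: linL_0 linL_add)

lemma linL_compose: "linL f \<Longrightarrow> linL g \<Longrightarrow> linL (\<lambda>v. f (g v))"
  by (simp add: linL_def)

lemma linL_sum_fun: "(\<And>i. i \<in> I \<Longrightarrow> linL (f i)) \<Longrightarrow> linL (\<lambda>v. \<Sum>i\<in>I. f i v)"
  by (simp add: linL_def sum.distrib sum_distrib_left)

lemma linL_zero: "linL (\<lambda>v. 0)" and linL_id: "linL (\<lambda>v. v)"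
  by (simp_all add: linL_def)

lemma linL_plus: "linL f \<Longrightarrow> linL g \<Longrightarrow> linL (\<lambda>v. f v + g v)"
  by (simp add: linL_def algebra_simps)

lemma linL_mult: "linL f \<Longrightarrow> linL (\<lambda>v. w * f v)"
  by (simp add: linL_def algebra_simps)

section \<open>Composable operators\<close>

text \<open>\<open>a(z1) b(z2) v\<close> lies in \<open>(z1 z2)^N L0[[z1, z2]]\<close>. A bound in
  both variables at once makes every coefficient of \<open>a(z) b(z) v\<close> a finite sum.\<close>

definition low_bound :: "oper \<Rightarrow> oper \<Rightarrow> L0 \<Rightarrow> int \<Rightarrow> bool"
  where "low_bound a b v N \<longleftrightarrow> (\<forall>i j. i < N \<or> j < N \<longrightarrow> a (b v $$ j) $$ i = 0)"

definition composable :: "oper \<Rightarrow> oper \<Rightarrow> bool"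
  where "composable a b \<longleftrightarrow> (\<forall>v. \<exists>N. low_bound a b v N)"

definition linO :: "oper \<Rightarrow> bool"
  where "linO a \<longleftrightarrow> (\<forall>n. linL (\<lambda>v. a v $$ n))"

lemma linO_D: "linO a \<Longrightarrow> linL (\<lambda>v. a v $$ n)"
  by (simp add: linO_def)

lemma linO_0: "linO a \<Longrightarrow> a 0 = 0"
  by (intro fls_eqI) (simp add: linL_0[OF linO_D])

lemma composableE:
  assumes "composable a b"
  obtains N where "low_bound a b v N"
  using assms unfolding composable_def by metis

text \<open>Nonzero terms have \<open>j >= N\<close> and \<open>n - j >= N\<close>. Any finite
  superset is allowed, so that several coefficients or vectors can share one range of
  summation.\<close>

lemma omult_nth_superset:
  assumes N: "low_bound a b v N"
    and J: "finite J" "{N..n - N} \<subseteq> J"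
  shows "omult a b v $$ n = (\<Sum>j\<in>J. a (b v $$ j) $$ (n - j))"
proof -
  have eq: "Sum_any (\<lambda>j. a (b v $$ j) $$ (n - j)) = (\<Sum>j\<in>J. a (b v $$ j) $$ (n - j))"
    if "finite J" "{N..n - N} \<subseteq> J" for n J
    by (rule Sum_any.expand_superset[OF that(1)]) (use N that(2) in \<open>force simp: low_bound_def\<close>)
  have "omult a b v $$ n = Sum_any (\<lambda>j. a (b v $$ j) $$ (n - j))"
    unfolding omult_def
  proof (rule nth_Abs_fls_lower_bound)
    show "\<forall>n<2 * N. Sum_any (\<lambda>j. a (b v $$ j) $$ (n - j)) = 0"
      using eq[of "{}"] by simp
  qed
  then show ?thesis using eq[OF J] by simp
qed

lemma linO_omult:
  assumes "composable a b" "linO a" "linO b"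
  shows "linO (omult a b)"
  unfolding linO_def linL_def
proof (intro allI conjI)
  fix n u v
  obtain N1 where N1: "low_bound a b u N1"
    using composableE[OF assms(1)] by blast
  obtain N2 where N2: "low_bound a b v N2"
    using composableE[OF assms(1)] by blast
  let ?N = "min N1 N2"
  have "omult a b (u + v) $$ n = (\<Sum>j\<in>{?N..n - ?N}. a (b (u + v) $$ j) $$ (n - j))"
    by (rule omult_nth_superset[where N = ?N])
      (use N1 N2 in \<open>auto simp: linL_add[OF linO_D] assms low_bound_def\<close>)
  also have "\<dots> = (\<Sum>j\<in>{?N..n - ?N}. a (b u $$ j) $$ (n - j)) + (\<Sum>j\<in>{?N..n - ?N}. a (b v $$ j) $$ (n - j))"
    by (simp add: linL_add[OF linO_D] assms sum.distrib)
  also have "(\<Sum>j\<in>{?N..n - ?N}. a (b u $$ j) $$ (n - j)) = omult a b u $$ n"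
    by (rule omult_nth_superset[symmetric, OF N1]) auto
  also have "(\<Sum>j\<in>{?N..n - ?N}. a (b v $$ j) $$ (n - j)) = omult a b v $$ n"
    by (rule omult_nth_superset[symmetric, OF N2]) auto
  finally show "omult a b (u + v) $$ n = omult a b u $$ n + omult a b v $$ n" .
next
  fix n c v
  obtain N where N: "low_bound a b v N"
    using composableE[OF assms(1)] by blast
  have "omult a b (cst c * v) $$ n = (\<Sum>j\<in>{N..n - N}. a (b (cst c * v) $$ j) $$ (n - j))"
    by (rule omult_nth_superset[where N = N])
      (use N in \<open>auto simp: linL_cst[OF linO_D] assms low_bound_def\<close>)
  also have "\<dots> = cst c * (\<Sum>j\<in>{N..n - N}. a (b v $$ j) $$ (n - j))"
    by (simp add: linL_cst[OF linO_D] assms sum_distrib_left)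
  also have "\<dots> = cst c * omult a b v $$ n"
    using omult_nth_superset[OF N, of "{N..n - N}" n] by simp
  finally show "omult a b (cst c * v) $$ n = cst c * omult a b v $$ n" .
qed

text \<open>The fields built from \<open>exp_z\<close>, \<open>exp_zinv\<close> and \<open>e_alpha_z\<close> satisfy
  \<open>[a(z), a(-r)] = g z\<^bsup>-r\<^esup> a(z)\<close> for scalars \<open>g\<close>.\<close>

definition shift_comm :: "oper \<Rightarrow> nat \<Rightarrow> F \<Rightarrow> bool"
  where "shift_comm a r g \<longleftrightarrow>
    (\<forall>v n. a (Avar r * v) $$ n = Avar r * a v $$ n + cst g * a v $$ (n + int r))"

lemma shift_commD:
  "shift_comm a r g \<Longrightarrow> a (Avar r * v) $$ n = Avar r * a v $$ n + cst g * a v $$ (n + int r)"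
  by (simp add: shift_comm_def)

text \<open>Taking the commutator with \<open>a(-r)\<close> is a derivation, so the scalars of the
  two factors add.\<close>

lemma shift_comm_omult:
  assumes "composable a b" "linO a" "linO b" "shift_comm a r g" "shift_comm b r h"
  shows "shift_comm (omult a b) r (g + h)"
  unfolding shift_comm_def
proof (intro allI)
  fix v n
  let ?A = "Avar r"
  obtain N1 where N1: "low_bound a b v N1"
    using composableE[OF assms(1)] by blast
  obtain N2 where N2: "low_bound a b (?A * v) N2"
    using composableE[OF assms(1)] by blast
  \<comment> \<open>Lowered by \<open>r\<close> because two of the sums below compute the
    coefficient at \<open>n + int r\<close>.\<close>
  define N where "N = min N1 N2 - int r"
  let ?J = "{N..n - N}"
  have "omult a b (?A * v) $$ n = (\<Sum>j\<in>?J. a (b (?A * v) $$ j) $$ (n - j))"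
    by (rule omult_nth_superset[OF N2]) (auto simp: N_def)
  also have "\<dots> = (\<Sum>j\<in>?J. ?A * a (b v $$ j) $$ (n - j) + cst g * a (b v $$ j) $$ (n + int r - j)
      + cst h * a (b v $$ (j + int r)) $$ (n + int r - (j + int r)))"
    by (intro sum.cong refl)
      (simp add: shift_commD[OF assms(5)] shift_commD[OF assms(4)] linL_add[OF linO_D[OF assms(2)]]
        linL_cst[OF linO_D[OF assms(2)]] diff_add_eq)
  also have "\<dots> = ?A * (\<Sum>j\<in>?J. a (b v $$ j) $$ (n - j)) + cst g * (\<Sum>j\<in>?J. a (b v $$ j) $$ (n + int r - j))
      + cst h * (\<Sum>j\<in>?J. a (b v $$ (j + int r)) $$ (n + int r - (j + int r)))"
    by (simp only: sum.distrib sum_distrib_left)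
  also have "(\<Sum>j\<in>?J. a (b v $$ j) $$ (n - j)) = omult a b v $$ n"
    by (rule omult_nth_superset[symmetric, OF N1]) (auto simp: N_def)
  also have "(\<Sum>j\<in>?J. a (b v $$ j) $$ (n + int r - j)) = omult a b v $$ (n + int r)"
    by (rule omult_nth_superset[symmetric, OF N1]) (auto simp: N_def)
  also have "(\<Sum>j\<in>?J. a (b v $$ (j + int r)) $$ (n + int r - (j + int r))) =
      (\<Sum>j\<in>{N + int r..n - N + int r}. a (b v $$ j) $$ (n + int r - j))"
    by (rule sum.reindex_bij_witness[of _ "\<lambda>j. j - int r" "\<lambda>j. j + int r"]) auto
  also have "\<dots> = omult a b v $$ (n + int r)"
    by (rule omult_nth_superset[symmetric, OF N1]) (auto simp: N_def)
  finally show "omult a b (?A * v) $$ n = ?A * omult a b v $$ n + cst (g + h) * omult a b v $$ (n + int r)"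
    by (simp add: cst_add algebra_simps)
qed

text \<open>Meant for the factors of \<open>x_hat\<close>: finitely many Laurent series have a
  common lower bound.\<close>

lemma composable_finite:
  assumes "\<And>v. finite {j. b v $$ j \<noteq> 0}" "linO a"
  shows "composable a b"
  unfolding composable_def low_bound_def
proof
  fix v
  let ?J = "{j. b v $$ j \<noteq> 0}"
  have "\<exists>N. \<forall>j\<in>J. \<forall>i. i < N \<or> j < N \<longrightarrow> a (b v $$ j) $$ i = 0" if "finite J" for J
    using that
  proof induction
    case (insert k J)
    then obtain N where N: "\<forall>j\<in>J. \<forall>i. i < N \<or> j < N \<longrightarrow> a (b v $$ j) $$ i = 0" by blast
    obtain M where M: "\<forall>n<M. a (b v $$ k) $$ n = 0" by (elim fls_nth_vanishes_belowE)
    show ?case by (rule exI[of _ "min N (min M k)"]) (use N M in auto)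
  qed auto
  from this[OF assms(1)] obtain N where N: "\<forall>j\<in>?J. \<forall>i. i < N \<or> j < N \<longrightarrow> a (b v $$ j) $$ i = 0"
    by blast
  show "\<exists>N. \<forall>i j. i < N \<or> j < N \<longrightarrow> a (b v $$ j) $$ i = 0"
    by (rule exI[of _ N]) (use N linO_0[OF assms(2)] in force)
qed

lemma omult_single_mode:
  assumes "\<And>j. j \<noteq> k \<Longrightarrow> b v $$ j = 0" "linO a"
  shows "omult a b v $$ n = a (b v $$ k) $$ (n - k)"
proof -
  have "{j. b v $$ j \<noteq> 0} \<subseteq> {k}" using assms(1) by auto
  then have fin: "finite {j. b v $$ j \<noteq> 0}" by (rule finite_subset) simp
  have "(\<Sum>j | b v $$ j \<noteq> 0. a (b v $$ j) $$ (n - j)) = (\<Sum>j\<in>{k}. a (b v $$ j) $$ (n - j))"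
    by (rule sum.mono_neutral_left) (use fin assms linO_0[OF assms(2)] in auto)
  then show ?thesis
    by (subst omult_nth) (use fin assms(2) linO_0 in auto)
qed

section \<open>Modes of the exponentials\<close>

text \<open>The scalar \<open>[a(r), a(-r)]\<close>. With \<open>bco\<close> and \<open>kco\<close>
  below, the exponents of \<open>x_plus\<close> have coefficients \<open>bco r\<close> and
  \<open>- bco r\<close>, and that of \<open>k_hat\<close> has \<open>- kco r\<close>.\<close>

definition kap :: "nat \<Rightarrow> F"
  where "kap r = qint (2 * r) * qint r / of_nat r"

definition bco :: "nat \<Rightarrow> F"
  where "bco r = inverse qh ^ r / qint r"

definition kco :: "nat \<Rightarrow> F"
  where "kco r = (q - inverse q) * (qh ^ r / (1 + q ^ (2 * r)))"

text \<open>\<open>qh ^ n\<close> is the class of a monomial of degree \<open>n\<close>, so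
  comparing degrees shows that it is a constant only for \<open>n = 0\<close>.\<close>

lemma qh_power_neq_1: "n \<noteq> 0 \<Longrightarrow> qh ^ n \<noteq> 1" and one_plus_qh_power_neq_0: "n \<noteq> 0 \<Longrightarrow> 1 + qh ^ n \<noteq> 0"
  and qh_neq_0: "qh \<noteq> 0"
proof -
  have pow: "qh ^ n = Fract (monom 1 n) 1" for n
    by (induction n) (simp_all add: qh_def One_fract_def monom_Suc)
  have eq: "qh ^ n = Fract [:c:] 1 \<Longrightarrow> n = 0" for n c
    unfolding pow by (auto simp: eq_fract dest!: arg_cong[where f = degree] simp: degree_monom_eq)
  show "qh ^ n \<noteq> 1" if "n \<noteq> 0"
  proof
    assume "qh ^ n = 1"
    then have "qh ^ n = Fract [:1:] 1" by (simp add: One_fract_def one_pCons)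
    with eq that show False by blast
  qed
  show "1 + qh ^ n \<noteq> 0" if "n \<noteq> 0"
  proof
    assume "1 + qh ^ n = 0"
    then have "qh ^ n = - 1" by (simp add: eq_neg_iff_add_eq_0 add.commute)
    then have "qh ^ n = Fract [:- 1:] 1" by (simp add: One_fract_def one_pCons)
    with eq that show False by blast
  qed
  show "qh \<noteq> 0" by (simp add: qh_def Zero_fract_def eq_fract)
qed

lemma q_neq_0: "q \<noteq> 0"
  by (simp add: q_def qh_neq_0)

lemma q_power_neq_1: "n \<noteq> 0 \<Longrightarrow> q ^ n \<noteq> 1"
  using qh_power_neq_1[of "2 * n"] by (simp add: q_def power_mult)

lemma one_plus_q_power_neq_0: "n \<noteq> 0 \<Longrightarrow> 1 + q ^ n \<noteq> 0"
  using one_plus_qh_power_neq_0[of "2 * n"] by (simp add: q_def power_mult)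

lemma q_minus_inverse_neq_0: "n \<noteq> 0 \<Longrightarrow> q ^ n - inverse q ^ n \<noteq> 0"
proof
  assume "n \<noteq> 0" "q ^ n - inverse q ^ n = 0"
  then have "q ^ n * q ^ n = 1"
    using q_neq_0 by (simp add: power_inverse field_simps)
  then have "q ^ (2 * n) = 1"
    by (simp only: mult_2 power_add)
  then show False using q_power_neq_1[of "2 * n"] \<open>n \<noteq> 0\<close> by simp
qed

text \<open>This identity is what makes the contraction of \<open>x_hat\<close> with itself equal to \<open>(z\<^sub>1 - z\<^sub>2)\<^sup>2\<close>.\<close>

lemma contraction_exponent:
  assumes "r \<ge> 1"
  shows "of_nat r * bco r * ((bco r + kco r) * kap r) = 2"
proof -
  define t where "t = qh ^ r"
  have t: "t \<noteq> 0" using qh_neq_0 by (simp add: t_def)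
  have qr: "q ^ r = t ^ 2" by (simp add: q_def t_def flip: power_mult) (simp add: mult.commute)
  have q2r: "q ^ (2 * r) = t ^ 4"
    unfolding mult.commute[of 2 r] power_mult qr by (simp flip: power_mult)
  define d where "d = q - inverse q"
  have d: "d \<noteq> 0" using q_minus_inverse_neq_0[of 1] by (simp add: d_def)
  have q1: "qint r = (t ^ 2 - inverse t ^ 2) / d"
    by (simp add: qint_def qr power_inverse d_def)
  have q2: "qint (2 * r) = (t ^ 4 - inverse t ^ 4) / d"
    by (simp add: qint_def q2r power_inverse d_def)
  have n1: "t ^ 2 - inverse t ^ 2 \<noteq> 0"
    using q_minus_inverse_neq_0[of r] assms by (simp add: qr power_inverse)
  have n2: "1 + t ^ 4 \<noteq> 0"
    using one_plus_q_power_neq_0[of "2 * r"] assms by (simp add: q2r)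
  have n3: "of_nat r \<noteq> (0 :: F)" using assms by simp
  have fac: "t ^ 4 - inverse t ^ 4 = (t ^ 2 - inverse t ^ 2) * (t ^ 2 + inverse t ^ 2)"
    by algebra
  define s where "s = t ^ 2 - inverse t ^ 2"
  have "of_nat r * bco r * ((bco r + kco r) * kap r) =
      inverse t * (inverse t * d / s + d * (t / (1 + t ^ 4))) * (s * (t ^ 2 + inverse t ^ 2) / d)"
    using n1 n3 d unfolding bco_def kco_def kap_def q1 q2 fac q2r s_def[symmetric] d_def[symmetric]
    by (simp add: power_inverse t_def[symmetric])
  also have "\<dots> = inverse t * inverse t * (t ^ 2 + inverse t ^ 2) + s * (t ^ 2 + inverse t ^ 2) / (1 + t ^ 4)"
  proof -
    have "inverse t * (inverse t * d / s + d * (t / u)) * (s * w / d) = inverse t * inverse t * w + s * w / u"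
      if "u \<noteq> 0" for u w
      using n1 d t that unfolding s_def[symmetric] by (simp add: field_simps)
    from this[OF n2] show ?thesis .
  qed
  \<comment> \<open>The denominator \<open>1 + t ^ 4\<close> coming from \<open>k_hat\<close>
    divides this factor exactly. What remains is
    \<open>(1 + t^(-4)) + (1 - t^(-4)) = 2\<close>.\<close>
  also have "s * (t ^ 2 + inverse t ^ 2) = (1 - inverse t ^ 4) * (1 + t ^ 4)"
    using t unfolding s_def by (simp add: field_simps)
  also have "inverse t * inverse t * (t ^ 2 + inverse t ^ 2) + (1 - inverse t ^ 4) * (1 + t ^ 4) / (1 + t ^ 4) = 2"
    unfolding nonzero_mult_div_cancel_right[OF n2]
    using t by (simp add: field_simps power2_eq_square power4_eq_xxxx)
  finally show ?thesis .
qed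

section \<open>The creation exponential\<close>

definition Pser :: "L0 fps"
  where "Pser = Abs_fps (\<lambda>r. if r = 0 then 0 else cst (bco r) * Avar r)"

text \<open>Coefficient of \<open>z^k\<close> in \<open>exp(Pser)\<close>: the \<open>a(-r)\<close>
  commute, so the creation exponential is multiplication by a power series. \<open>Pser\<close> has
  no constant term, hence the cut at \<open>n \<le> k\<close>.\<close>

definition hco :: "nat \<Rightarrow> L0"
  where "hco k = (\<Sum>n\<le>k. cst (1 / fact n) * (Pser ^ n $ k))"

text \<open>The Laurent form lets indices run below 0, where the coefficients vanish.\<close>

definition H :: "L0 fls"
  where "H = fps_to_fls (Abs_fps hco)"

lemma coeff_pow_a_neg:
  "coeff_pow (\<lambda>r v. scaleL (bco r) (a_neg r v)) n k v = (Pser ^ n $ k) * v"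
proof (induction n arbitrary: k)
  case (Suc n)
  have "coeff_pow (\<lambda>r v. scaleL (bco r) (a_neg r v)) (Suc n) k v =
      (\<Sum>r = 1..k. Pser $ r * (Pser ^ n $ (k - r)) * v)"
    unfolding coeff_pow.simps Suc
    by (intro sum.cong refl) (simp add: scaleL_cst a_neg_Avar, simp add: Pser_def)
  also have "\<dots> = (\<Sum>r = 0..k. Pser $ r * (Pser ^ n $ (k - r)) * v)"
    by (simp add: sum.atLeast_Suc_atMost Pser_def)
  finally show ?case by (simp add: fps_mult_nth sum_distrib_right)
qed (simp add: fps_one_def)

lemma coeff_exp_a_neg:
  "coeff_exp (\<lambda>r v. scaleL (bco r) (a_neg r v)) k v = hco k * v"
  unfolding coeff_exp_def coeff_pow_a_neg hco_def
  by (simp add: sum_distrib_right scaleL_cst mult.assoc)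

lemma exp_z_a_neg_nth:
  "exp_z (\<lambda>r v. scaleL (bco r) (a_neg r v)) v $$ k = H $$ k * v"
  by (simp add: exp_z_def coeff_exp_a_neg H_def)

lemma Pser_power_nth_0: "k < n \<Longrightarrow> Pser ^ n $ k = 0"
  by (rule startsby_zero_power_prefix[rule_format]) (auto simp: Pser_def)

lemma hco_extend: "k \<le> K \<Longrightarrow> hco k = (\<Sum>n\<le>K. cst (1 / fact n) * (Pser ^ n $ k))"
  unfolding hco_def by (rule sum.mono_neutral_left) (auto simp: Pser_power_nth_0)

text \<open>Coefficient form of \<open>z E' = z P' E\<close> for \<open>E = exp P\<close>. Through
  this recursion later inductions avoid handling the exponential itself.\<close>

lemma hco_rec: "of_nat k * hco k = (\<Sum>r = 1..k. of_nat r * cst (bco r) * Avar r * hco (k - r))"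
proof (cases k)
  case (Suc K)
  have "of_nat k * (Pser ^ Suc n $ k) = of_nat (Suc n) * (\<Sum>r = 1..k. of_nat r * Pser $ r * (Pser ^ n $ (k - r)))" for n
  proof -
    have "of_nat k * (Pser ^ Suc n $ k) = fps_deriv (Pser ^ Suc n) $ K"
      by (simp add: Suc del: power_Suc)
    also have "\<dots> = of_nat (Suc n) * ((fps_deriv Pser * Pser ^ n) $ K)"
      by (simp only: fps_deriv_power diff_Suc_1 mult.assoc fps_mult_left_const_nth)
    also have "(fps_deriv Pser * Pser ^ n) $ K = (\<Sum>r = 1..k. of_nat r * Pser $ r * (Pser ^ n $ (k - r)))"
      unfolding fps_mult_nth
      by (rule sum.reindex_bij_witness[of _ "\<lambda>r. r - 1" Suc]) (auto simp: Suc)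
    finally show ?thesis .
  qed note pow = this
  have inv: "cst (1 / fact (Suc n)) * of_nat (Suc n) = cst (1 / fact n)" for n
    by (simp del: of_nat_Suc flip: cst_of_nat cst_mult)
  have "of_nat k * hco k = (\<Sum>n\<le>Suc K. cst (1 / fact n) * (of_nat k * (Pser ^ n $ k)))"
    unfolding hco_def Suc sum_distrib_left by (intro sum.cong refl mult.left_commute)
  also have "\<dots> = (\<Sum>n\<le>K. cst (1 / fact (Suc n)) * (of_nat k * (Pser ^ Suc n $ k)))"
    unfolding sum.atMost_Suc_shift by (simp add: Suc)
  also have "\<dots> = (\<Sum>n\<le>K. cst (1 / fact n) * (\<Sum>r = 1..k. of_nat r * Pser $ r * (Pser ^ n $ (k - r))))"
    unfolding pow mult.assoc[symmetric] inv ..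
  also have "\<dots> = (\<Sum>r = 1..k. \<Sum>n\<le>K. of_nat r * Pser $ r * (cst (1 / fact n) * (Pser ^ n $ (k - r))))"
    unfolding sum_distrib_left by (subst sum.swap) (simp add: ac_simps)
  also have "\<dots> = (\<Sum>r = 1..k. of_nat r * cst (bco r) * Avar r * hco (k - r))"
  proof (rule sum.cong[OF refl])
    fix r assume r: "r \<in> {1..k}"
    then have "k - r \<le> K" using Suc by auto
    from hco_extend[OF this] show "(\<Sum>n\<le>K. of_nat r * Pser $ r * (cst (1 / fact n) * (Pser ^ n $ (k - r)))) =
        of_nat r * cst (bco r) * Avar r * hco (k - r)"
      using r by (simp add: Pser_def mult.assoc flip: sum_distrib_left)
  qed
  finally show ?thesis .
qed simp

lemma H_nth: "H $$ k = (if k < 0 then 0 else hco (nat k))"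
  by (simp add: H_def)

lemma H_0 [simp]: "H $$ 0 = 1"
  by (simp add: H_nth hco_def)

text \<open>The cutoff \<open>K\<close> may exceed \<open>k\<close>, so that one range of summation
  serves several neighbouring indices.\<close>

lemma H_rec:
  assumes "k \<le> int K"
  shows "of_int k * H $$ k = (\<Sum>r = 1..K. of_nat r * cst (bco r) * Avar r * H $$ (k - int r))"
proof (cases "k < 0")
  case True
  then show ?thesis by (simp add: H_nth)
next
  case False
  then obtain k' where k': "k = int k'" by (cases k) auto
  have "(\<Sum>r = 1..K. of_nat r * cst (bco r) * Avar r * H $$ (k - int r)) =
      (\<Sum>r = 1..k'. of_nat r * cst (bco r) * Avar r * H $$ (k - int r))"
    by (rule sum.mono_neutral_right) (use assms k' in \<open>auto simp: H_nth\<close>)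
  also have "\<dots> = (\<Sum>r = 1..k'. of_nat r * cst (bco r) * Avar r * hco (k' - r))"
    by (rule sum.cong) (auto simp: H_nth k' nat_diff_distrib)
  finally show ?thesis by (simp add: k' H_nth hco_rec)
qed

section \<open>The annihilation operators and their exponentials\<close>

lemma a_pos_add: "a_pos r (u + v) = a_pos r u + a_pos r v"
  by (rule poly_mapping_eqI) (simp add: lookup_a_pos lookup_add aK_pos_add)

lemma a_pos_mult0:
  "a_pos r (Poly_Mapping.single 0 p * v) = Poly_Mapping.single 0 p * a_pos r v + Poly_Mapping.single 0 (aK_pos r p) * v"
  by (rule poly_mapping_eqI) (simp add: lookup_a_pos lookup_add lookup_0_mult aK_pos_mult)

lemma linL_a_pos: "linL (a_pos r)"
  by (simp add: linL_def a_pos_add cst_def a_pos_mult0 aK_pos_const)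

lemma a_pos_Avar:
  assumes "r \<ge> 1" "s \<ge> 1"
  shows "a_pos r (Avar s * v) = Avar s * a_pos r v + (if r = s then cst (kap s) * v else 0)"
  using assms by (simp add: Avar_def a_pos_mult0 aK_pos_avar cst_def kap_def)

lemma aK_pos_0: "aK_pos r 0 = 0"
  by (simp add: aK_pos_def)

lemma a_pos_evec: "a_pos r (evec n) = 0"
proof -
  have "aK_pos r 1 = 0" using aK_pos_const[of r 1] by simp
  then show ?thesis
    by (intro poly_mapping_eqI) (simp add: lookup_a_pos evec_def lookup_single when_def aK_pos_0)
qed

definition Th_pow :: "(nat \<Rightarrow> F) \<Rightarrow> nat \<Rightarrow> nat \<Rightarrow> L0 \<Rightarrow> L0"
  where "Th_pow g = coeff_pow (\<lambda>r v. scaleL (g r) (a_pos r v))"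

definition Th :: "(nat \<Rightarrow> F) \<Rightarrow> nat \<Rightarrow> L0 \<Rightarrow> L0"
  where "Th g = coeff_exp (\<lambda>r v. scaleL (g r) (a_pos r v))"

lemma Th_pow_0: "Th_pow g 0 k v = (if k = 0 then v else 0)"
  and Th_pow_Suc: "Th_pow g (Suc n) k v = (\<Sum>r = 1..k. cst (g r) * a_pos r (Th_pow g n (k - r) v))"
  by (simp_all add: Th_pow_def scaleL_cst)

lemma Th_Th_pow: "Th g k v = (\<Sum>n\<le>k. cst (1 / fact n) * Th_pow g n k v)"
  by (simp add: Th_def Th_pow_def coeff_exp_def scaleL_cst)

lemma linL_Th_pow: "linL (Th_pow g n k)"
proof (induction n arbitrary: k)
  case 0
  show ?case by (simp add: linL_def Th_pow_0)
next
  case (Suc n)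
  show ?case unfolding Th_pow_Suc
    by (intro linL_sum_fun linL_mult linL_compose[OF linL_a_pos] Suc)
qed

lemma linL_Th: "linL (Th g k)"
  unfolding Th_Th_pow by (intro linL_sum_fun linL_mult linL_Th_pow)

lemma Th_pow_eq_0: "k < n \<Longrightarrow> Th_pow g n k v = 0"
proof (induction n arbitrary: k)
  case (Suc n)
  have "Th_pow g n (k - r) v = 0" if "r \<in> {1..k}" for r
    by (rule Suc.IH) (use that Suc.prems in auto)
  then show ?case by (simp add: Th_pow_Suc linL_0[OF linL_a_pos])
qed simp

text \<open>For \<open>A(w) = sum g(r) a(r) w^r\<close> the commutator of \<open>A(w)\<close> with
  \<open>a(-s)\<close> is the scalar \<open>g(s) kap(s) w^s\<close>, so that of \<open>A^n\<close>
  is \<open>n\<close> times this scalar times \<open>A^(n-1)\<close>.\<close>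

lemma Th_pow_Avar:
  assumes "s \<ge> 1"
  shows "Th_pow g n k (Avar s * v) = Avar s * Th_pow g n k v
    + (if s \<le> k then of_nat n * cst (g s * kap s) * Th_pow g (n - 1) (k - s) v else 0)"
proof (induction n arbitrary: k)
  case 0
  then show ?case by (simp add: Th_pow_0)
next
  case (Suc n)
  let ?c = "cst (g s * kap s)"
  have "Th_pow g (Suc n) k (Avar s * v) = (\<Sum>r = 1..k. cst (g r) * (Avar s * a_pos r (Th_pow g n (k - r) v)
      + (if r = s then cst (kap s) * Th_pow g n (k - r) v else 0)
      + (if s \<le> k - r then of_nat n * ?c * a_pos r (Th_pow g (n - 1) (k - r - s) v) else 0)))"
    unfolding Th_pow_Suc
  proof (intro sum.cong refl arg_cong[where f = "\<lambda>w. cst _ * w"])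
    fix r assume r: "r \<in> {1..k}"
    have "a_pos r (of_nat n * ?c * w) = of_nat n * ?c * a_pos r w" for w
      by (simp add: mult.assoc linL_of_nat[OF linL_a_pos] linL_cst[OF linL_a_pos])
    then show "a_pos r (Th_pow g n (k - r) (Avar s * v)) = Avar s * a_pos r (Th_pow g n (k - r) v)
      + (if r = s then cst (kap s) * Th_pow g n (k - r) v else 0)
      + (if s \<le> k - r then of_nat n * ?c * a_pos r (Th_pow g (n - 1) (k - r - s) v) else 0)"
      using r assms by (simp add: Suc linL_add[OF linL_a_pos] a_pos_Avar linL_0[OF linL_a_pos])
  qed
  also have "\<dots> = Avar s * Th_pow g (Suc n) k v
      + (\<Sum>r = 1..k. if r = s then ?c * Th_pow g n (k - r) v else 0)
      + of_nat n * ?c * (\<Sum>r = 1..k. if s \<le> k - r then cst (g r) * a_pos r (Th_pow g (n - 1) (k - r - s) v) else 0)"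
    unfolding Th_pow_Suc sum_distrib_left sum.distrib[symmetric]
    by (intro sum.cong refl) (auto simp: cst_mult algebra_simps)
  also have "(\<Sum>r = 1..k. if r = s then ?c * Th_pow g n (k - r) v else 0) =
      (if s \<le> k then ?c * Th_pow g n (k - s) v else 0)"
    using assms by simp
  also have "of_nat n * ?c * (\<Sum>r = 1..k. if s \<le> k - r then cst (g r) * a_pos r (Th_pow g (n - 1) (k - r - s) v) else 0)
      = (if s \<le> k then of_nat n * ?c * Th_pow g n (k - s) v else 0)"
  \<comment> \<open>In the main case the sum applies \<open>A\<close> once more and restores the
    power \<open>n\<close>. Otherwise the prefactor \<open>of_nat n\<close> or every summand is
    0.\<close>
  proof (cases "s \<le> k \<and> n \<noteq> 0")
    case True
    then obtain n' where n': "n = Suc n'" using not0_implies_Suc by auto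
    have "(\<Sum>r = 1..k. if s \<le> k - r then cst (g r) * a_pos r (Th_pow g n' (k - r - s) v) else 0) =
        (\<Sum>r = 1..k - s. cst (g r) * a_pos r (Th_pow g n' (k - s - r) v))"
      by (rule sum.mono_neutral_cong_right) (use True in \<open>auto simp: add.commute\<close>)
    then show ?thesis using True unfolding n' diff_Suc_1 by (simp add: Th_pow_Suc)
  next
    case False
    show ?thesis
    proof (cases "n = 0")
      case True then show ?thesis by simp
    next
      case nz: False
      with False have "s > k" by simp
      then show ?thesis by (auto intro!: sum.neutral)
    qed
  qed
  finally show ?case by (simp add: algebra_simps)
qed

text \<open>The scalar commutators recombine into the same exponential because
  \<open>n / n! = 1 / (n-1)!\<close>.\<close>

lemma Th_Avar:
  assumes "s \<ge> 1"
  shows "Th g k (Avar s * v) = Avar s * Th g k v + (if s \<le> k then cst (g s * kap s) * Th g (k - s) v else 0)"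
proof (cases "s \<le> k")
  case True
  let ?c = "cst (g s * kap s)"
  obtain K where K: "k = Suc K" using True assms by (cases k) auto
  have inv: "cst (1 / fact (Suc n)) * of_nat (Suc n) = cst (1 / fact n)" for n
    by (simp del: of_nat_Suc flip: cst_of_nat cst_mult)
  have "Th g k (Avar s * v) = Avar s * Th g k v + ?c * (\<Sum>n\<le>k. cst (1 / fact n) * of_nat n * Th_pow g (n - 1) (k - s) v)"
    unfolding Th_Th_pow Th_pow_Avar[OF assms] sum_distrib_left sum.distrib[symmetric]
    by (intro sum.cong refl) (use True in \<open>simp add: algebra_simps\<close>)
  also have "(\<Sum>n\<le>k. cst (1 / fact n) * of_nat n * Th_pow g (n - 1) (k - s) v) = (\<Sum>n\<le>K. cst (1 / fact n) * Th_pow g n (k - s) v)"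
    unfolding K sum.atMost_Suc_shift by (simp add: inv del: of_nat_Suc fact_Suc)
  also have "\<dots> = Th g (k - s) v"
    unfolding Th_Th_pow by (rule sum.mono_neutral_right) (use K assms in \<open>auto simp: Th_pow_eq_0\<close>)
  finally show ?thesis using True by simp
next
  case False
  then show ?thesis
    unfolding Th_Th_pow Th_pow_Avar[OF assms] by (simp add: sum_distrib_left algebra_simps)
qed

lemma Th_evec: "Th g k (evec n) = (if k = 0 then evec n else 0)"
proof -
  have pow: "Th_pow g m k (evec n) = (if m = 0 \<and> k = 0 then evec n else 0)" for m k
  proof (induction m arbitrary: k)
    case (Suc m)
    show ?case unfolding Th_pow_Suc Suc
      by (auto simp: a_pos_evec linL_0[OF linL_a_pos] intro!: sum.neutral)
  qed (simp add: Th_pow_0)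
  show ?thesis unfolding Th_Th_pow pow by (simp add: if_distrib cong: if_cong)
qed

lemma exp_zinv_Th:
  "exp_zinv (\<lambda>r v. scaleL (g r) (a_pos r v)) v $$ n = (if n \<le> 0 then Th g (nat (- n)) v else 0)"
  by (simp add: exp_zinv_a_pos_nth Th_def)

lemma finite_exp_zinv: "finite {j. exp_zinv (\<lambda>r v. scaleL (g r) (a_pos r v)) v $$ j \<noteq> 0}"
proof -
  obtain N where N: "\<And>k. k > N \<Longrightarrow> Th g k v = 0"
    using coeff_exp_a_pos_eventually_0[of g v] by (auto simp: Th_def)
  have "{j. exp_zinv (\<lambda>r v. scaleL (g r) (a_pos r v)) v $$ j \<noteq> 0} \<subseteq> {- int N..0}"
  proof
    fix j assume "j \<in> {j. exp_zinv (\<lambda>r v. scaleL (g r) (a_pos r v)) v $$ j \<noteq> 0}"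
    then have "j \<le> 0" "Th g (nat (- j)) v \<noteq> 0" by (auto simp: exp_zinv_Th split: if_splits)
    with N[of "nat (- j)"] have "nat (- j) \<le> N" by (meson not_le)
    with \<open>j \<le> 0\<close> show "j \<in> {- int N..0}" by auto
  qed
  then show ?thesis by (rule finite_subset) simp
qed

lemma linO_exp_zinv: "linO (exp_zinv (\<lambda>r v. scaleL (g r) (a_pos r v)))"
  unfolding linO_def exp_zinv_Th
proof
  show "linL (\<lambda>v. if n \<le> 0 then Th g (nat (- n)) v else 0)" for n
    by (cases "n \<le> 0") (simp_all add: linL_Th linL_zero)
qed

lemma shift_comm_exp_zinv:
  assumes "r \<ge> 1"
  shows "shift_comm (exp_zinv (\<lambda>r v. scaleL (g r) (a_pos r v))) r (g r * kap r)"
  using assms unfolding shift_comm_def exp_zinv_Th Th_Avar[OF assms]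
  by (auto simp: nat_diff_distrib' nat_le_iff intro!: arg_cong[where f = "\<lambda>k. _ * Th g k _"])

lemma exp_zinv_evec:
  "exp_zinv (\<lambda>r v. scaleL (g r) (a_pos r v)) (evec n) $$ k = (if k = 0 then evec n else 0)"
  by (simp add: exp_zinv_Th Th_evec)

section \<open>The modes of \<open>x_hat\<close>\<close>

lemma fls_sum_nth: "sum f I $$ n = (\<Sum>i\<in>I. f i $$ n)"
  by (induction I rule: infinite_finite_induct) simp_all

lemma e_alpha_z_nth:
  "e_alpha_z v $$ k = (if even k then Poly_Mapping.single (k div 2 + 1) (Poly_Mapping.lookup v (k div 2)) else 0)"
proof -
  have "e_alpha_z v $$ k = (\<Sum>n\<in>Poly_Mapping.keys v. if 2 * n = k then Poly_Mapping.single (n + 1) (Poly_Mapping.lookup v n) else 0)"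
    unfolding e_alpha_z_def fls_sum_nth
    by (intro sum.cong refl) (auto simp: mult_single add.commute)
  also have "\<dots> = (\<Sum>n\<in>Poly_Mapping.keys v. if n = k div 2 then (if even k then Poly_Mapping.single (n + 1) (Poly_Mapping.lookup v n) else 0) else 0)"
    by (intro sum.cong refl) auto
  also have "\<dots> = (if even k then Poly_Mapping.single (k div 2 + 1) (Poly_Mapping.lookup v (k div 2)) else 0)"
    by (auto simp: sum.delta in_keys_iff)
  finally show ?thesis .
qed

lemma finite_e_alpha_z: "finite {j. e_alpha_z v $$ j \<noteq> 0}"
proof -
  have "{j. e_alpha_z v $$ j \<noteq> 0} \<subseteq> (\<lambda>n. 2 * n) ` Poly_Mapping.keys v"
  proof
    fix j assume "j \<in> {j. e_alpha_z v $$ j \<noteq> 0}"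
    then have "even j" "j div 2 \<in> Poly_Mapping.keys v"
      by (auto simp: e_alpha_z_nth in_keys_iff split: if_splits)
    then show "j \<in> (\<lambda>n. 2 * n) ` Poly_Mapping.keys v" by (intro image_eqI[of _ _ "j div 2"]) auto
  qed
  then show ?thesis by (rule finite_subset) simp
qed

lemma linO_e_alpha_z: "linO e_alpha_z"
  unfolding linO_def linL_def e_alpha_z_nth
  by (auto simp: lookup_add single_add cst_def lookup_0_mult mult_single)

lemma shift_comm_e_alpha_z: "shift_comm e_alpha_z r 0"
  unfolding shift_comm_def e_alpha_z_nth
  by (auto simp: Avar_def lookup_0_mult mult_single)

abbreviation "exp_neg \<equiv> exp_z (\<lambda>r v. scaleL (bco r) (a_neg r v))"
abbreviation "exp_pos g \<equiv> exp_zinv (\<lambda>r v. scaleL (g r) (a_pos r v))"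

lemma linO_exp_neg: "linO exp_neg"
  by (simp add: linO_def exp_z_a_neg_nth linL_mult linL_id)

lemma shift_comm_exp_neg: "shift_comm exp_neg r 0"
  by (simp add: shift_comm_def exp_z_a_neg_nth)

lemma x_hat_eq:
  "x_hat = omult (omult (omult exp_neg (exp_pos (\<lambda>r. - bco r))) e_alpha_z) (exp_pos (\<lambda>r. - kco r))"
  by (simp add: x_hat_def x_plus_def k_hat_def bco_def kco_def)

text \<open>Minus the scalar by which \<open>x_hat\<close> fails to commute with
  \<open>a(-r)\<close>; the annihilation parts of both \<open>x_plus\<close> and
  \<open>k_hat\<close> contribute.\<close>

definition gam :: "nat \<Rightarrow> F"
  where "gam r = (bco r + kco r) * kap r"

lemma composable_factors:
  "composable exp_neg (exp_pos (\<lambda>r. - bco r))"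
  "linO (omult exp_neg (exp_pos (\<lambda>r. - bco r)))"
  "composable (omult exp_neg (exp_pos (\<lambda>r. - bco r))) e_alpha_z"
  "linO (omult (omult exp_neg (exp_pos (\<lambda>r. - bco r))) e_alpha_z)"
  "composable (omult (omult exp_neg (exp_pos (\<lambda>r. - bco r))) e_alpha_z) (exp_pos (\<lambda>r. - kco r))"
proof -
  show 1: "composable exp_neg (exp_pos (\<lambda>r. - bco r))"
    by (intro composable_finite finite_exp_zinv linO_exp_neg)
  show 2: "linO (omult exp_neg (exp_pos (\<lambda>r. - bco r)))"
    by (intro linO_omult 1 linO_exp_neg linO_exp_zinv)
  show 3: "composable (omult exp_neg (exp_pos (\<lambda>r. - bco r))) e_alpha_z"
    by (intro composable_finite finite_e_alpha_z 2)
  show 4: "linO (omult (omult exp_neg (exp_pos (\<lambda>r. - bco r))) e_alpha_z)"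
    by (intro linO_omult 2 3 linO_e_alpha_z)
  show "composable (omult (omult exp_neg (exp_pos (\<lambda>r. - bco r))) e_alpha_z) (exp_pos (\<lambda>r. - kco r))"
    by (intro composable_finite finite_exp_zinv 4)
qed

lemma linO_x_hat: "linO x_hat"
  unfolding x_hat_eq by (intro linO_omult composable_factors linO_exp_zinv)

lemma shift_comm_x_hat: "r \<ge> 1 \<Longrightarrow> shift_comm x_hat r (- gam r)"
proof -
  assume r: "r \<ge> 1"
  have "shift_comm x_hat r (0 + (- bco r) * kap r + 0 + (- kco r) * kap r)"
    unfolding x_hat_eq
    by (intro shift_comm_omult composable_factors linO_exp_neg linO_exp_zinv linO_e_alpha_z
        shift_comm_exp_neg shift_comm_e_alpha_z shift_comm_exp_zinv[OF r])
  then show ?thesis by (simp add: gam_def algebra_simps)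
qed

text \<open>On \<open>e^(n alpha)\<close> both annihilation exponentials are the identity and
  \<open>e_alpha_z\<close> has a single nonzero mode, so only the creation series is left.\<close>

lemma x_hat_evec: "x_hat (evec n) $$ k = H $$ (k - 2 * n) * evec (n + 1)"
proof -
  have e: "e_alpha_z (evec n) $$ j = (if j = 2 * n then evec (n + 1) else 0)" for j
    by (auto simp: e_alpha_z_nth evec_def lookup_single when_def)
  have "x_hat (evec n) $$ k = omult (omult exp_neg (exp_pos (\<lambda>r. - bco r))) e_alpha_z (evec n) $$ k"
    unfolding x_hat_eq
    by (subst omult_single_mode[where k = 0]) (simp_all add: exp_zinv_evec composable_factors)
  also have "\<dots> = omult exp_neg (exp_pos (\<lambda>r. - bco r)) (evec (n + 1)) $$ (k - 2 * n)"
    by (subst omult_single_mode[where k = "2 * n"]) (simp_all add: e composable_factors)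
  also have "\<dots> = exp_neg (evec (n + 1)) $$ (k - 2 * n)"
    by (subst omult_single_mode[where k = 0]) (simp_all add: exp_zinv_evec linO_exp_neg)
  finally show ?thesis by (simp add: exp_z_a_neg_nth)
qed

section \<open>Contraction, commutativity and square of \<open>x_hat\<close>\<close>

abbreviation X :: "int \<Rightarrow> L0 \<Rightarrow> L0"
  where "X k v \<equiv> x_hat v $$ k"

lemma linL_X: "linL (X k)"
  by (rule linO_D[OF linO_x_hat])

lemma X_Avar: "r \<ge> 1 \<Longrightarrow> X k (Avar r * v) = Avar r * X k v - cst (gam r) * X (k + int r) v"
  using shift_commD[OF shift_comm_x_hat] by (simp add: cst_uminus)

lemma bco_gam: "r \<ge> 1 \<Longrightarrow> of_nat r * cst (bco r) * cst (gam r) = 2"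
  using arg_cong[OF contraction_exponent[of r], of cst]
  by (simp add: gam_def cst_of_nat cst_mult cst_numeral mult.assoc)

lemma sum_telescope_nat:
  fixes w :: "nat \<Rightarrow> 'a :: ab_group_add"
  shows "(\<Sum>r = 1..K. w r - w (Suc r)) = w 1 - w (Suc K)"
  by (induction K) simp_all

lemma linL_weighted: "linL f \<Longrightarrow> f (of_nat r * cst b * v) = of_nat r * cst b * f v"
  by (simp add: mult.assoc linL_of_nat linL_cst)

text \<open>The mode version of \<open>x_hat(z\<^sub>1)E(z\<^sub>2)e\<^bsup>n\<alpha>\<^esup> = z\<^sub>1\<^bsup>2n\<^esup>(1 - z\<^sub>2/z\<^sub>1)\<^sup>2E(z\<^sub>1)E(z\<^sub>2)e\<^bsup>(n+1)\<alpha>\<^esup>\<close>, where \<open>E(z) = \<Sum>\<^sub>k H\<^sub>k z\<^sup>k\<close>.\<close>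

definition HH :: "int \<Rightarrow> int \<Rightarrow> L0"
  where "HH a c = H $$ a * H $$ c - 2 * (H $$ (a + 1) * H $$ (c - 1)) + H $$ (a + 2) * H $$ (c - 2)"

text \<open>Induction on \<open>c\<close> by \<open>H_rec\<close> in the second variable, as
  \<open>H $$ c\<close> is built from the \<open>Avar r\<close> and smaller coefficients, and
  \<open>X a\<close> has a known commutator with \<open>Avar r\<close>.\<close>

lemma X_H_evec: "X a (H $$ c * evec n) = HH (a - 2 * n) c * evec (n + 1)"
proof (induction "nat c" arbitrary: a c rule: less_induct)
  case less
  show ?case
  proof (cases "c \<le> 0")
    case True
    show ?thesis
    proof (cases "c = 0")
      case True
      then show ?thesis using x_hat_evec[of n a] by (simp add: HH_def H_nth[of "-1"] H_nth[of "-2"])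
    next
      case False
      with True show ?thesis by (simp add: HH_def H_nth[of c] H_nth[of "c - 1"] H_nth[of "c - 2"] linL_0[OF linL_X])
    qed
  next
    case False
    define K where "K = nat c"
    have K: "c = int K" using False by (simp add: K_def)
    define s where "s = a - 2 * n"
    let ?w = "\<lambda>r. of_nat r * cst (bco r)"
    have IH: "X a' (H $$ (c - int r) * evec n) = HH (a' - 2 * n) (c - int r) * evec (n + 1)" if "r \<in> {1..K}" for r a'
      by (rule less) (use that K in auto)
    have rec: "(\<Sum>r = 1..K. ?w r * Avar r * H $$ (j - int r)) = of_int j * H $$ j" if "j \<le> c" for j
      using H_rec[of j K] that K by (simp add: mult.assoc)
    have "of_int c * X a (H $$ c * evec n) = X a (of_int c * H $$ c * evec n)"
      by (simp add: linL_of_int[OF linL_X] mult.assoc)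
    also have "\<dots> = X a (\<Sum>r = 1..K. ?w r * (Avar r * (H $$ (c - int r) * evec n)))"
      by (simp add: rec[symmetric] sum_distrib_right mult.assoc)
    also have "\<dots> = (\<Sum>r = 1..K. ?w r * X a (Avar r * (H $$ (c - int r) * evec n)))"
      by (simp only: linL_sum[OF linL_X] linL_weighted[OF linL_X])
    also have "\<dots> = (\<Sum>r = 1..K. ?w r * Avar r * (HH s (c - int r) * evec (n + 1)) - 2 * (HH (s + int r) (c - int r) * evec (n + 1)))"
    proof (intro sum.cong refl)
      fix r assume r: "r \<in> {1..K}"
      then have r1: "r \<ge> 1" by simp
      have sr: "a + int r - 2 * n = s + int r" by (simp add: s_def)
      show "?w r * X a (Avar r * (H $$ (c - int r) * evec n)) =
          ?w r * Avar r * (HH s (c - int r) * evec (n + 1)) - 2 * (HH (s + int r) (c - int r) * evec (n + 1))"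
        unfolding X_Avar[OF r1] IH[OF r] sr s_def[symmetric] bco_gam[OF r1, symmetric]
        by (simp add: algebra_simps)
    qed
    also have "\<dots> = ((\<Sum>r = 1..K. ?w r * Avar r * HH s (c - int r)) - 2 * (\<Sum>r = 1..K. HH (s + int r) (c - int r))) * evec (n + 1)"
      by (simp add: sum_subtractf sum_distrib_left sum_distrib_right algebra_simps)
    also have "(\<Sum>r = 1..K. ?w r * Avar r * HH s (c - int r)) =
        H $$ s * (\<Sum>r = 1..K. ?w r * Avar r * H $$ (c - int r))
        - 2 * (H $$ (s + 1) * (\<Sum>r = 1..K. ?w r * Avar r * H $$ (c - 1 - int r)))
        + H $$ (s + 2) * (\<Sum>r = 1..K. ?w r * Avar r * H $$ (c - 2 - int r))"
      unfolding sum_distrib_left sum_subtractf[symmetric] sum.distrib[symmetric]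
    proof (intro sum.cong refl)
      fix r
      have i: "c - int r - 1 = c - 1 - int r" "c - int r - 2 = c - 2 - int r" by simp_all
      show "?w r * Avar r * HH s (c - int r) = H $$ s * (?w r * Avar r * H $$ (c - int r))
        - 2 * (H $$ (s + 1) * (?w r * Avar r * H $$ (c - 1 - int r)))
        + H $$ (s + 2) * (?w r * Avar r * H $$ (c - 2 - int r))"
        unfolding HH_def i by (simp add: distrib_left right_diff_distrib mult.left_commute mult.assoc)
    qed
    \<comment> \<open>The same cutoff \<open>K\<close> works for the recursion at \<open>c\<close>,
      \<open>c - 1\<close> and \<open>c - 2\<close>.\<close>
    also have "\<dots> = H $$ s * (of_int c * H $$ c) - 2 * (H $$ (s + 1) * (of_int (c - 1) * H $$ (c - 1)))
        + H $$ (s + 2) * (of_int (c - 2) * H $$ (c - 2))"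
      by (subst (1 2 3) rec) simp_all
    also have "(\<Sum>r = 1..K. HH (s + int r) (c - int r)) = H $$ (s + 1) * H $$ (c - 1) - H $$ (s + 2) * H $$ (c - 2)"
    proof -
      \<comment> \<open>\<open>HH\<close> is a second difference of \<open>u\<close> along an
        antidiagonal, so the sum telescopes twice; beyond \<open>K\<close> the second index is
        negative and \<open>u\<close> vanishes.\<close>
      define u where "u r = H $$ (s + int r) * H $$ (c - int r)" for r
      have u0: "u r = 0" if "r > K" for r 
      proof -
        have "c - int r < 0" using that K by simp
        then show ?thesis by (simp add: u_def H_nth[of "c - int r"])
      qed
      have "HH (s + int r) (c - int r) = (u r - u (Suc r)) - (u (Suc r) - u (Suc (Suc r)))" for r
        by (simp add: HH_def u_def algebra_simps)
      then have "(\<Sum>r = 1..K. HH (s + int r) (c - int r)) = (\<Sum>r = 1..K. (u r - u (Suc r)) - (u (Suc r) - u (Suc (Suc r))))"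
        by simp
      also have "\<dots> = (u 1 - u 2) - (u (Suc K) - u (Suc (Suc K)))"
        using sum_telescope_nat[of "\<lambda>r. u r - u (Suc r)" K] by (simp add: numeral_2_eq_2)
      finally show ?thesis by (simp add: u0) (simp add: u_def)
    qed
    \<comment> \<open>The telescoped terms turn all weights into \<open>c\<close>:
      \<open>-2 (c-1) - 2 = -2 c\<close> and \<open>(c-2) + 2 = c\<close>.\<close>
    also have "(H $$ s * (of_int c * H $$ c) - 2 * (H $$ (s + 1) * (of_int (c - 1) * H $$ (c - 1)))
        + H $$ (s + 2) * (of_int (c - 2) * H $$ (c - 2))
        - 2 * (H $$ (s + 1) * H $$ (c - 1) - H $$ (s + 2) * H $$ (c - 2))) * evec (n + 1)
        = of_int c * (HH s c * evec (n + 1))"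
      by (simp add: HH_def algebra_simps)
    finally have "of_int c * X a (H $$ c * evec n) = of_int c * (HH s c * evec (n + 1))" .
    then show ?thesis using False by (simp add: s_def)
  qed
qed

text \<open>On \<open>e^(n alpha)\<close> the contraction \<open>(z1 - z2)^2\<close> is symmetric in
  the two variables, and both orders have the same commutator with every
  \<open>a(-r)\<close>.\<close>

lemma X_commute: "X a (X b v) = X b (X a v)"
proof (induction v arbitrary: a b rule: L0_induct)
  case (3 n)
  have i: "a - 2 * (n + 1) = a - 2 * n - 2" "b - 2 * (n + 1) = b - 2 * n - 2" by simp_all
  show ?case
    unfolding x_hat_evec X_H_evec i by (simp add: HH_def algebra_simps)
next
  case (4 r v)
  then show ?case
    by (simp add: X_Avar linL_diff[OF linL_X] linL_cst[OF linL_X])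
qed (simp_all add: linL_add[OF linL_X] linL_cst[OF linL_X])

text \<open>Either operator may act first on \<open>v\<close>, so the lower bounds of
  \<open>a v\<close> and \<open>b v\<close> bound both indices.\<close>

lemma composable_commute:
  assumes "linO a" "linO b" "\<And>i j v. a (b v $$ j) $$ i = b (a v $$ i) $$ j"
  shows "composable a b"
  unfolding composable_def low_bound_def
proof
  fix v
  obtain N where N: "\<forall>n<N. a v $$ n = 0" by (elim fls_nth_vanishes_belowE)
  obtain M where M: "\<forall>n<M. b v $$ n = 0" by (elim fls_nth_vanishes_belowE)
  show "\<exists>N. \<forall>i j. i < N \<or> j < N \<longrightarrow> a (b v $$ j) $$ i = 0"
  proof (intro exI[of _ "min N M"] allI impI)
    fix i j assume "i < min N M \<or> j < min N M"
    then show "a (b v $$ j) $$ i = 0"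
    proof
      assume "i < min N M"
      then have "a v $$ i = 0" using N by simp
      then show ?thesis by (simp add: assms(3) linO_0[OF assms(2)])
    next
      assume "j < min N M"
      then have "b v $$ j = 0" using M by simp
      then show ?thesis by (simp add: linO_0[OF assms(1)])
    qed
  qed
qed

lemma composable_x_hat: "composable x_hat x_hat"
  by (intro composable_commute linO_x_hat X_commute)

text \<open>The contraction vanishes at \<open>z1 = z2\<close>: in modes, a second difference with
  finite support sums to 0.\<close>

lemma x_hat_square_evec: "omult x_hat x_hat (evec n) $$ k = 0"
proof -
  obtain N where N: "low_bound x_hat x_hat (evec n) N" using composableE[OF composable_x_hat] by blast
  \<comment> \<open>With this lower end the range covers the support of \<open>f\<close> after each
    of the shifts 0, 1 and 2.\<close>
  define L where "L = min N (2 * n)"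
  let ?J = "{L..k - L}"
  define M where "M = k - 4 * n"
  define f where "f i = H $$ (M - 2 - i) * H $$ i" for i
  have f0: "f i = 0" if "i < 0 \<or> i > M - 2" for i
    using that by (auto simp: f_def H_nth)
  have shift: "(\<Sum>j\<in>?J. f (j - 2 * n - s)) = (\<Sum>i\<in>{0..M - 2}. f i)" if "0 \<le> s" "s \<le> 2" for s
  proof -
    have "(\<Sum>j\<in>?J. f (j - 2 * n - s)) = (\<Sum>i\<in>{L - 2 * n - s..k - L - 2 * n - s}. f i)"
      by (rule sum.reindex_bij_witness[of _ "\<lambda>i. i + 2 * n + s" "\<lambda>j. j - 2 * n - s"]) auto
    also have "\<dots> = (\<Sum>i\<in>{0..M - 2}. f i)"
      by (rule sum.mono_neutral_right) (use that f0 in \<open>auto simp: L_def M_def\<close>)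
    finally show ?thesis .
  qed
  have "omult x_hat x_hat (evec n) $$ k = (\<Sum>j\<in>?J. X (k - j) (X j (evec n)))"
    by (rule omult_nth_superset[OF N]) (auto simp: L_def)
  also have "\<dots> = (\<Sum>j\<in>?J. (f (j - 2 * n - 0) - 2 * f (j - 2 * n - 1) + f (j - 2 * n - 2)) * evec (n + 2))"
    unfolding x_hat_evec X_H_evec
    by (intro sum.cong refl) (simp add: HH_def f_def M_def algebra_simps)
  also have "\<dots> = ((\<Sum>j\<in>?J. f (j - 2 * n - 0)) - 2 * (\<Sum>j\<in>?J. f (j - 2 * n - 1)) + (\<Sum>j\<in>?J. f (j - 2 * n - 2))) * evec (n + 2)"
    by (simp only: sum_distrib_left[symmetric] sum_distrib_right[symmetric] sum.distrib sum_subtractf)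
  also have "\<dots> = 0"
    by (subst (1 2 3) shift) simp_all
  finally show ?thesis .
qed

lemma x_hat_square: "omult x_hat x_hat = 0"
proof (intro ext fls_eqI)
  fix v n
  have lin: "linL (\<lambda>v. omult x_hat x_hat v $$ n)" for n
    by (intro linO_D linO_omult composable_x_hat linO_x_hat)
  have "omult x_hat x_hat v $$ n = 0"
  proof (induction v arbitrary: n rule: L0_induct)
    case (3 m)
    show ?case by (rule x_hat_square_evec)
  next
    case (4 r v)
    have "shift_comm (omult x_hat x_hat) r (- gam r + - gam r)"
      by (intro shift_comm_omult composable_x_hat linO_x_hat shift_comm_x_hat 4)
    then show ?case by (simp add: shift_commD 4)
  qed (simp_all add: linL_add[OF lin] linL_cst[OF lin])
  then show "omult x_hat x_hat v $$ n = 0 v $$ n" by simp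
qed

text \<open>The shift 2 is \<open>(alpha, alpha)\<close>, picked up when \<open>e^alpha\<close>
  passes the operator \<open>z^(partial_alpha)\<close>.\<close>

lemma X_evec_mult: "X k (evec 1 * v) = evec 1 * X (k - 2) v"
proof (induction v arbitrary: k rule: L0_induct)
  case (3 n)
  show ?case by (simp add: evec_mult x_hat_evec algebra_simps)
next
  case (4 r v)
  have "X k (evec 1 * (Avar r * v)) = X k (Avar r * (evec 1 * v))" by (simp add: mult.left_commute)
  also have "\<dots> = evec 1 * X (k - 2) (Avar r * v)"
    using 4 by (simp add: X_Avar right_diff_distrib mult.left_commute diff_add_eq)
  finally show ?case .
next
  case (2 c v)
  have "X k (evec 1 * (cst c * v)) = X k (cst c * (evec 1 * v))" by (simp add: mult.left_commute)
  then show ?case using 2 by (simp add: linL_cst[OF linL_X])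
qed (simp_all add: linL_add[OF linL_X] algebra_simps)

section \<open>The grading by powers of \<open>e^alpha\<close>\<close>

definition charge :: "int \<Rightarrow> L0 \<Rightarrow> L0"
  where "charge m v = Poly_Mapping.single m (Poly_Mapping.lookup v m)"

lemma linL_charge: "linL (charge m)"
  by (simp add: linL_def charge_def lookup_add single_add cst_def lookup_0_mult mult_single)

text \<open>Membership in \<open>K(1)\<close>, phrased so that stability under sums and products is
  immediate.\<close>

definition charge_0 :: "L0 \<Rightarrow> bool"
  where "charge_0 w \<longleftrightarrow> (\<forall>m v. charge m (w * v) = w * charge m v)"

lemma charge_0_sum: "(\<And>i. i \<in> I \<Longrightarrow> charge_0 (f i)) \<Longrightarrow> charge_0 (sum f I)"
  by (simp add: charge_0_def sum_distrib_right linL_sum[OF linL_charge])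

lemma charge_0_mult: "charge_0 u \<Longrightarrow> charge_0 w \<Longrightarrow> charge_0 (u * w)"
  by (simp add: charge_0_def mult.assoc)

lemma charge_0_single: "charge_0 (Poly_Mapping.single 0 p)"
  by (simp add: charge_0_def charge_def lookup_0_mult mult_single)

lemma charge_0_H: "charge_0 (H $$ k)"
proof -
  have zero: "charge_0 0" using charge_0_single[of 0] by simp
  have one: "charge_0 1" by (simp add: charge_0_def)
  have P: "charge_0 (Pser $ r)" for r
    by (simp add: Pser_def zero charge_0_mult charge_0_single cst_def Avar_def)
  have "charge_0 (Pser ^ n $ k)" for n k
    by (induction n arbitrary: k) (auto simp: fps_mult_nth zero one P intro!: charge_0_sum charge_0_mult)
  then have "charge_0 (hco k)" for k
    unfolding hco_def by (intro charge_0_sum charge_0_mult) (simp_all add: cst_def charge_0_single)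
  then show ?thesis by (simp add: H_nth zero)
qed

lemma charge_evec: "charge m (evec n) = (if m = n then evec n else 0)"
  by (simp add: charge_def evec_def lookup_single when_def)

lemma charge_X: "charge (m + 1) (X k v) = X k (charge m v)"
proof (induction v arbitrary: k rule: L0_induct)
  case (3 n)
  show ?case
    using charge_0_H[of "k - 2 * n"]
    by (auto simp: x_hat_evec charge_0_def charge_evec linL_0[OF linL_X])
next
  case (4 r v)
  have A: "charge m (Avar r * w) = Avar r * charge m w" for m w
    using charge_0_single[of "avar r"] by (simp add: charge_0_def Avar_def)
  show ?case using 4 by (simp add: A X_Avar linL_diff[OF linL_charge] linL_cst[OF linL_charge])
qed (simp_all add: linL_add[OF linL_X] linL_cst[OF linL_X] linL_add[OF linL_charge] linL_cst[OF linL_charge])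

text \<open>With half the exponents of \<open>x_hat\<close> the contraction with \<open>x_hat(z)\<close> becomes \<open>1 - z/w\<close>; its
  coefficient of highest degree in \<open>w\<^bsup>-1\<^esup>\<close> lowers the index of every \<open>X k\<close> by one.\<close>

definition half :: "nat \<Rightarrow> F"
  where "half r = - (bco r + kco r) / 2"

definition R :: "int \<Rightarrow> L0 \<Rightarrow> L0"
  where "R j v = (if j < 0 then 0 else Th half (nat j) v)"

lemma linL_R: "linL (R j)"
  by (cases "j < 0") (simp_all add: R_def[abs_def] linL_zero linL_Th)

lemma R_evec: "R j (evec n) = (if j = 0 then evec n else 0)"
  by (auto simp: R_def Th_evec)

lemma R_Avar: "r \<ge> 1 \<Longrightarrow> R j (Avar r * v) = Avar r * R j v + cst (half r * kap r) * R (j - int r) v"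
  by (auto simp: R_def Th_Avar nat_diff_distrib' nat_le_iff le_nat_iff)

lemma bco_half: "r \<ge> 1 \<Longrightarrow> of_nat r * cst (bco r) * cst (half r * kap r) = - 1"
proof -
  assume r: "r \<ge> 1"
  have "of_nat r * bco r * (half r * kap r) = - (of_nat r * bco r * ((bco r + kco r) * kap r)) / 2"
    by (simp add: half_def algebra_simps)
  also have "\<dots> = - 1" using contraction_exponent[OF r] by simp
  finally have "cst (of_nat r * bco r * (half r * kap r)) = cst (- 1)" by simp
  then show ?thesis by (simp add: cst_of_nat cst_mult cst_uminus mult.assoc)
qed

text \<open>Same induction as for \<open>X_H_evec\<close>. The contraction \<open>1 - z/w\<close> is
  linear, so only \<open>j = 0\<close> and \<open>j = 1\<close> survive and the correction terms
  telescope once.\<close>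

lemma R_H_evec: "R j (H $$ c * evec n) = ((if j = 0 then H $$ c else 0) - (if j = 1 then H $$ (c - 1) else 0)) * evec n"
proof (induction "nat c" arbitrary: j c rule: less_induct)
  case less
  define E where "E j c = (if j = 0 then H $$ c else 0) - (if j = 1 then H $$ (c - 1) else 0)" for j c :: int
  have "R j (H $$ c * evec n) = E j c * evec n"
  proof (cases "c \<le> 0")
    case True
    show ?thesis
    proof (cases "c = 0")
      case True
      then show ?thesis by (simp add: E_def R_evec H_nth[of "-1"])
    next
      case False
      with True show ?thesis by (simp add: E_def H_nth[of c] H_nth[of "c - 1"] linL_0[OF linL_R])
    qed
  next
    case False
    define K where "K = nat c"
    have K: "c = int K" using False by (simp add: K_def)
    let ?w = "\<lambda>r. of_nat r * cst (bco r)"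
    have IH: "R j' (H $$ (c - int r) * evec n) = E j' (c - int r) * evec n" if "r \<in> {1..K}" for r j'
      unfolding E_def by (rule less) (use that K in auto)
    have rec: "(\<Sum>r = 1..K. ?w r * Avar r * H $$ (j - int r)) = of_int j * H $$ j" if "j \<le> c" for j
      using H_rec[of j K] that K by (simp add: mult.assoc)
    have "of_int c * R j (H $$ c * evec n) = R j (of_int c * H $$ c * evec n)"
      by (simp add: linL_of_int[OF linL_R] mult.assoc)
    also have "\<dots> = R j (\<Sum>r = 1..K. ?w r * (Avar r * (H $$ (c - int r) * evec n)))"
      by (simp add: rec[symmetric] sum_distrib_right mult.assoc)
    also have "\<dots> = (\<Sum>r = 1..K. ?w r * R j (Avar r * (H $$ (c - int r) * evec n)))"
      by (simp only: linL_sum[OF linL_R] linL_weighted[OF linL_R])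
    also have "\<dots> = (\<Sum>r = 1..K. ?w r * Avar r * (E j (c - int r) * evec n) - E (j - int r) (c - int r) * evec n)"
    proof (intro sum.cong refl)
      fix r assume r: "r \<in> {1..K}"
      then have r1: "r \<ge> 1" by simp
      have "?w r * R j (Avar r * (H $$ (c - int r) * evec n)) =
          ?w r * Avar r * (E j (c - int r) * evec n) + (?w r * cst (half r * kap r)) * (E (j - int r) (c - int r) * evec n)"
        unfolding R_Avar[OF r1] IH[OF r] by (simp only: distrib_left mult.assoc)
      then show "?w r * R j (Avar r * (H $$ (c - int r) * evec n)) =
          ?w r * Avar r * (E j (c - int r) * evec n) - E (j - int r) (c - int r) * evec n"
        unfolding bco_half[OF r1] by simp
    qed
    also have "\<dots> = ((\<Sum>r = 1..K. ?w r * Avar r * E j (c - int r)) - (\<Sum>r = 1..K. E (j - int r) (c - int r))) * evec n"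
      by (simp add: sum_subtractf sum_distrib_right left_diff_distrib mult.assoc)
    also have "(\<Sum>r = 1..K. ?w r * Avar r * E j (c - int r)) =
        (if j = 0 then (\<Sum>r = 1..K. ?w r * Avar r * H $$ (c - int r)) else 0)
        - (if j = 1 then (\<Sum>r = 1..K. ?w r * Avar r * H $$ (c - 1 - int r)) else 0)"
    proof -
      have i: "c - int r - 1 = c - 1 - int r" for r by simp
      show ?thesis by (auto simp: E_def sum_negf i)
    qed
    also have "\<dots> = (if j = 0 then of_int c * H $$ c else 0) - (if j = 1 then of_int (c - 1) * H $$ (c - 1) else 0)"
      by (subst (1 2) rec) simp_all
    also have "(\<Sum>r = 1..K. E (j - int r) (c - int r)) = (if j = 1 then H $$ (c - 1) else 0)"
    proof -
      define u where "u r = (if j = int r then H $$ (c - int r) else 0)" for r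
      have "E (j - int r) (c - int r) = u r - u (Suc r)" for r
        by (auto simp: E_def u_def algebra_simps)
      then have "(\<Sum>r = 1..K. E (j - int r) (c - int r)) = u 1 - u (Suc K)"
        using sum_telescope_nat[of u K] by simp
      then show ?thesis by (simp add: u_def K H_nth[of "-1"])
    qed
    also have "((if j = 0 then of_int c * H $$ c else 0) - (if j = 1 then of_int (c - 1) * H $$ (c - 1) else 0)
        - (if j = 1 then H $$ (c - 1) else 0)) * evec n = of_int c * (E j c * evec n)"
      by (simp add: E_def algebra_simps)
    finally have "of_int c * R j (H $$ c * evec n) = of_int c * (E j c * evec n)" .
    then show ?thesis using False by simp
  qed
  then show ?case by (simp add: E_def)
qed

text \<open>Mode form of \<open>R(w) x_hat(z) = (1 - z/w) x_hat(z) R(w)\<close>, checked on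
  \<open>e^(n alpha)\<close> and propagated along the \<open>a(-r)\<close>.\<close>

lemma R_X: "R j (X k v) = X k (R j v) - X (k - 1) (R (j - 1) v)"
proof (induction v arbitrary: j k rule: L0_induct)
  case (3 n)
  have i: "k - 2 * n - 1 = k - 1 - 2 * n" by simp
  show ?case
    by (simp add: i x_hat_evec R_H_evec R_evec linL_0[OF linL_X])
next
  case (4 r v)
  have i: "k + int r - 1 = k - 1 + int r" "j - int r - 1 = j - 1 - int r" by simp_all
  have "R j (X k (Avar r * v)) = R j (Avar r * X k v) - cst (gam r) * R j (X (k + int r) v)"
    by (simp only: X_Avar[OF 4(1)] linL_diff[OF linL_R] linL_cst[OF linL_R])
  also have "\<dots> = Avar r * (X k (R j v) - X (k - 1) (R (j - 1) v))
      + cst (half r * kap r) * (X k (R (j - int r) v) - X (k - 1) (R (j - 1 - int r) v))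
      - cst (gam r) * (X (k + int r) (R j v) - X (k - 1 + int r) (R (j - 1) v))"
    by (simp only: R_Avar[OF 4(1)] 4(2) i)
  also have "\<dots> = X k (R j (Avar r * v)) - X (k - 1) (R (j - 1) (Avar r * v))"
    by (simp only: R_Avar[OF 4(1)] X_Avar[OF 4(1)] linL_add[OF linL_X] linL_cst[OF linL_X])
      (simp add: algebra_simps)
  finally show ?case .
next
  case (1 u v)
  then show ?case by (simp add: linL_add[OF linL_X] linL_add[OF linL_R])
next
  case (2 c v)
  then show ?case by (simp add: linL_cst[OF linL_X] linL_cst[OF linL_R] right_diff_distrib)
qed

section \<open>The ring of operators in the double commutant of \<open>x_hat\<close>\<close>

definition X_centralizes :: "(L0 \<Rightarrow> L0) \<Rightarrow> bool"
  where "X_centralizes f \<longleftrightarrow> linL f \<and> (\<forall>k v. f (X k v) = X k (f v))"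

text \<open>A commutative ring large enough to contain \<open>W0\<close>. Modes of its members
  commute with whatever commutes with all \<open>X k\<close>; as the \<open>X k\<close> commute
  among themselves, the members commute with each other.\<close>

definition bicommutant :: "oper set"
  where "bicommutant = {a. linO a \<and> (\<forall>f. X_centralizes f \<longrightarrow> (\<forall>n v. a (f v) $$ n = f (a v $$ n)))}"

lemma bicommutantI:
  "linO a \<Longrightarrow> (\<And>f n v. X_centralizes f \<Longrightarrow> a (f v) $$ n = f (a v $$ n)) \<Longrightarrow> a \<in> bicommutant"
  by (simp add: bicommutant_def)

lemma bicommutant_linO: "a \<in> bicommutant \<Longrightarrow> linO a"
  by (simp add: bicommutant_def)

lemma bicommutant_centr: "a \<in> bicommutant \<Longrightarrow> X_centralizes f \<Longrightarrow> a (f v) $$ n = f (a v $$ n)"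
  by (simp add: bicommutant_def)

lemma X_centralizes_linL: "X_centralizes f \<Longrightarrow> linL f"
  by (simp add: X_centralizes_def)

text \<open>By \<open>X_commute\<close> each \<open>X k\<close> is itself a test operator
  \<open>f\<close>, so modes of members commute with the \<open>X k\<close> and become test
  operators in turn.\<close>

lemma X_centralizes_mode: "a \<in> bicommutant \<Longrightarrow> X_centralizes (\<lambda>v. a v $$ n)"
  using bicommutant_centr[of a "X k" for k] linO_D[OF bicommutant_linO]
  by (simp add: X_centralizes_def linL_X X_commute)

lemma bicommutant_commute:
  assumes "a \<in> bicommutant" "b \<in> bicommutant"
  shows "a (b v $$ j) $$ i = b (a v $$ i) $$ j"
  using bicommutant_centr[OF assms(1) X_centralizes_mode[OF assms(2)]] .

section \<open>Lower bounds and closure under the ring operations\<close>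

definition vanish_below :: "oper \<Rightarrow> L0 \<Rightarrow> int \<Rightarrow> bool"
  where "vanish_below a v N \<longleftrightarrow> (\<forall>n<N. a v $$ n = 0)"

lemma vanish_below_ex: "\<exists>N. vanish_below a v N"
proof -
  obtain N where "\<forall>n<N. a v $$ n = 0" by (elim fls_nth_vanishes_belowE)
  then show ?thesis by (auto simp: vanish_below_def)
qed

lemma vanish_below_mono: "vanish_below a v N \<Longrightarrow> M \<le> N \<Longrightarrow> vanish_below a v M"
  by (simp add: vanish_below_def)

lemma vanish_below_common2:
  obtains N where "vanish_below a v N" "vanish_below b v N"
proof -
  obtain N1 N2 where "vanish_below a v N1" "vanish_below b v N2" using vanish_below_ex by metis
  then show ?thesis by (intro that[of "min N1 N2"]) (auto intro: vanish_below_mono)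
qed

lemma vanish_below_common3:
  obtains N where "vanish_below a v N" "vanish_below b v N" "vanish_below c v N"
proof -
  obtain N1 N2 where "vanish_below a v N1" "vanish_below b v N1" "vanish_below c v N2"
    using vanish_below_ex vanish_below_common2 by metis
  then show ?thesis by (intro that[of "min N1 N2"]) (auto intro: vanish_below_mono)
qed

text \<open>Commuting the modes lets \<open>a\<close> act on \<open>v\<close> first, so the bound
  for \<open>v\<close> persists.\<close>

lemma vanish_below_mode:
  assumes "a \<in> bicommutant" "b \<in> bicommutant" "vanish_below a v N"
  shows "vanish_below a (b v $$ j) N"
  using assms bicommutant_commute[OF assms(1,2)] linO_0[OF bicommutant_linO[OF assms(2)]]
  by (simp add: vanish_below_def)

lemma low_bound_bicommutant:
  assumes "a \<in> bicommutant" "b \<in> bicommutant" "vanish_below a v N" "vanish_below b v N"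
  shows "low_bound a b v N"
  using vanish_below_mode[OF assms(1,2,3)] assms(4) linO_0[OF bicommutant_linO[OF assms(1)]]
  by (auto simp: vanish_below_def low_bound_def)

lemma omult_bicommutant_nth:
  assumes "a \<in> bicommutant" "b \<in> bicommutant" "vanish_below a v N" "vanish_below b v N"
    and "finite J" "{N..n - N} \<subseteq> J"
  shows "omult a b v $$ n = (\<Sum>j\<in>J. a (b v $$ j) $$ (n - j))"
  by (rule omult_nth_superset[OF low_bound_bicommutant]) fact+

lemma composable_bicommutant: "a \<in> bicommutant \<Longrightarrow> b \<in> bicommutant \<Longrightarrow> composable a b"
  by (intro composable_commute bicommutant_commute bicommutant_linO)

lemma x_hat_bicommutant: "x_hat \<in> bicommutant"
  by (intro bicommutantI linO_x_hat) (simp add: X_centralizes_def)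

lemma vac_bicommutant: "vac \<in> bicommutant"
  by (intro bicommutantI) (auto simp: linO_def linL_def vac_def X_centralizes_def linL_0)

lemma zero_bicommutant: "0 \<in> bicommutant"
  by (intro bicommutantI) (auto simp: linO_def linL_def linL_0[OF X_centralizes_linL])

lemma add_bicommutant: "a \<in> bicommutant \<Longrightarrow> b \<in> bicommutant \<Longrightarrow> a + b \<in> bicommutant"
  by (auto simp: bicommutant_def linO_def linL_plus linL_add[OF X_centralizes_linL])

lemma scaleH_nth_cst: "scaleH c a v $$ n = cst c * a v $$ n"
  by (simp add: scaleH_nth scaleL_cst)

lemma scaleH_bicommutant: "a \<in> bicommutant \<Longrightarrow> scaleH c a \<in> bicommutant"
  by (auto simp: bicommutant_def linO_def scaleH_nth_cst linL_mult linL_cst[OF X_centralizes_linL])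

lemma scaleH_minus_1: "scaleH (- 1) a = - a"
  by (intro ext fls_eqI) (simp add: scaleH_nth_cst cst_uminus)

lemma uminus_bicommutant: "a \<in> bicommutant \<Longrightarrow> - a \<in> bicommutant"
  using scaleH_bicommutant[of a "- 1"] by (simp add: scaleH_minus_1)

lemma diff_bicommutant: "a \<in> bicommutant \<Longrightarrow> b \<in> bicommutant \<Longrightarrow> a - b \<in> bicommutant"
  using add_bicommutant[of a "- b"] uminus_bicommutant[of b] by simp

lemma oderiv_nth: "oderiv a v $$ n = of_int (n + 1) * a v $$ (n + 1)"
  by (simp add: oderiv_def)

lemma oderiv_bicommutant: "a \<in> bicommutant \<Longrightarrow> oderiv a \<in> bicommutant"
  by (auto intro!: linL_mult simp: bicommutant_def linO_def oderiv_nth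
      linL_of_int[OF X_centralizes_linL] simp del: of_int_add)

lemma omult_bicommutant:
  assumes "a \<in> bicommutant" "b \<in> bicommutant"
  shows "omult a b \<in> bicommutant"
proof (rule bicommutantI)
  show "linO (omult a b)"
    by (intro linO_omult composable_bicommutant bicommutant_linO assms)
next
  fix f n v assume f: "X_centralizes f"
  obtain N where N: "vanish_below a v N" "vanish_below b v N" by (rule vanish_below_common2)
  have N': "vanish_below a (f v) N" "vanish_below b (f v) N"
    using N linL_0[OF X_centralizes_linL[OF f]]
    by (auto simp: vanish_below_def bicommutant_centr[OF _ f] assms)
  show "omult a b (f v) $$ n = f (omult a b v $$ n)"
    using omult_bicommutant_nth[OF assms N, of "{N..n - N}"] omult_bicommutant_nth[OF assms N', of "{N..n - N}"]
    by (simp add: linL_sum[OF X_centralizes_linL[OF f]] bicommutant_centr[OF _ f] assms)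
qed

lemma omult_commute:
  assumes "a \<in> bicommutant" "b \<in> bicommutant"
  shows "omult a b = omult b a"
proof (intro ext fls_eqI)
  fix v n
  obtain N where N: "vanish_below a v N" "vanish_below b v N" by (rule vanish_below_common2)
  have "omult a b v $$ n = (\<Sum>j\<in>{N..n - N}. a (b v $$ j) $$ (n - j))"
    by (rule omult_bicommutant_nth[OF assms N]) auto
  also have "\<dots> = (\<Sum>j\<in>{N..n - N}. b (a v $$ j) $$ (n - j))"
    by (rule sum.reindex_bij_witness[of _ "\<lambda>j. n - j" "\<lambda>j. n - j"])
      (auto simp: bicommutant_commute[OF assms(2,1)])
  also have "\<dots> = omult b a v $$ n"
    by (rule omult_bicommutant_nth[symmetric, OF assms(2,1) N(2,1)]) auto
  finally show "omult a b v $$ n = omult b a v $$ n" .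
qed

text \<open>Both sides are the same finite sum over three indices, each at least \<open>N\<close>,
  with total \<open>n\<close>; terms outside that simplex vanish.\<close>

lemma omult_assoc:
  assumes abc: "a \<in> bicommutant" "b \<in> bicommutant" "c \<in> bicommutant"
  shows "omult (omult a b) c = omult a (omult b c)"
proof (intro ext fls_eqI)
  fix v n
  obtain N where N: "vanish_below a v N" "vanish_below b v N" "vanish_below c v N" by (rule vanish_below_common3)
  \<comment> \<open>Products of two fields start at \<open>2 * N\<close>, which may lie on either
    side of \<open>N\<close>.\<close>
  define M where "M = min N (2 * N)"
  have van: "vanish_below (omult p r) v M"
    if "p \<in> bicommutant" "r \<in> bicommutant" "vanish_below p v N" "vanish_below r v N" for p r
    using omult_bicommutant_nth[OF that, of "{}"] by (simp add: vanish_below_def M_def)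
  have NM: "vanish_below a v M" "vanish_below c v M"
    using N by (auto intro: vanish_below_mono simp: M_def)
  have N': "vanish_below a (c v $$ k) N" "vanish_below b (c v $$ k) N" for k
    using N abc by (auto intro: vanish_below_mode)
  have "omult (omult a b) c v $$ n = (\<Sum>k\<in>{M..n - M}. omult a b (c v $$ k) $$ (n - k))"
    by (rule omult_bicommutant_nth[where N = M]) (use abc N NM omult_bicommutant van in auto)
  also have "\<dots> = (\<Sum>k\<in>{M..n - M}. \<Sum>i\<in>{N..n - k - N}. a (b (c v $$ k) $$ i) $$ (n - k - i))"
    by (intro sum.cong refl omult_bicommutant_nth[OF abc(1,2) N']) auto
  also have "\<dots> = (\<Sum>k\<in>{N..n - 2 * N}. \<Sum>i\<in>{N..n - k - N}. a (b (c v $$ k) $$ i) $$ (n - k - i))"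
  proof (rule sum.mono_neutral_right)
    show "\<forall>k\<in>{M..n - M} - {N..n - 2 * N}. (\<Sum>i\<in>{N..n - k - N}. a (b (c v $$ k) $$ i) $$ (n - k - i)) = 0"
    proof
      fix k assume k: "k \<in> {M..n - M} - {N..n - 2 * N}"
      show "(\<Sum>i\<in>{N..n - k - N}. a (b (c v $$ k) $$ i) $$ (n - k - i)) = 0"
      proof (cases "k < N")
        case True
        then have "c v $$ k = 0" using N(3) by (simp add: vanish_below_def)
        then show ?thesis
          by (simp add: linO_0[OF bicommutant_linO[OF abc(1)]] linO_0[OF bicommutant_linO[OF abc(2)]])
      next
        case False
        then show ?thesis using k by simp
      qed
    qed
  qed (auto simp: M_def)
  also have "\<dots> = (\<Sum>(k, i)\<in>(SIGMA k:{N..n - 2 * N}. {N..n - k - N}). a (b (c v $$ k) $$ i) $$ (n - k - i))"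
    by (simp add: sum.Sigma)
  also have "\<dots> = (\<Sum>(j, k)\<in>(SIGMA j:{2 * N..n - N}. {N..j - N}). a (b (c v $$ k) $$ (j - k)) $$ (n - j))"
    by (rule sum.reindex_bij_witness[of _ "\<lambda>(j, k). (k, j - k)" "\<lambda>(k, i). (k + i, k)"]) (auto simp: algebra_simps)
  also have "\<dots> = (\<Sum>j\<in>{2 * N..n - N}. \<Sum>k\<in>{N..j - N}. a (b (c v $$ k) $$ (j - k)) $$ (n - j))"
    by (simp add: sum.Sigma)
  also have "\<dots> = (\<Sum>j\<in>{2 * N..n - N}. a (omult b c v $$ j) $$ (n - j))"
  proof (intro sum.cong refl)
    fix j
    have "omult b c v $$ j = (\<Sum>k\<in>{N..j - N}. b (c v $$ k) $$ (j - k))"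
      by (rule omult_bicommutant_nth) (use abc N in auto)
    then show "(\<Sum>k\<in>{N..j - N}. a (b (c v $$ k) $$ (j - k)) $$ (n - j)) = a (omult b c v $$ j) $$ (n - j)"
      by (simp add: linL_sum[OF linO_D[OF bicommutant_linO[OF abc(1)]]])
  qed
  also have "\<dots> = (\<Sum>j\<in>{M..n - M}. a (omult b c v $$ j) $$ (n - j))"
  proof (rule sum.mono_neutral_left)
    show "\<forall>j\<in>{M..n - M} - {2 * N..n - N}. a (omult b c v $$ j) $$ (n - j) = 0"
    proof
      fix j assume j: "j \<in> {M..n - M} - {2 * N..n - N}"
      show "a (omult b c v $$ j) $$ (n - j) = 0"
      proof (cases "j < 2 * N")
        case True
        then have "omult b c v $$ j = 0"
          using omult_bicommutant_nth[OF abc(2,3) N(2,3), of "{}" j] by simp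
        then show ?thesis by (simp add: linO_0[OF bicommutant_linO[OF abc(1)]])
      next
        case False
        then have "n - j < N" using j by auto
        moreover have "vanish_below a (omult b c v $$ j) N"
          using vanish_below_mode[OF abc(1) omult_bicommutant[OF abc(2,3)] N(1)] .
        ultimately show ?thesis by (simp add: vanish_below_def)
      qed
    qed
  qed (auto simp: M_def)
  also have "\<dots> = omult a (omult b c) v $$ n"
    by (rule omult_bicommutant_nth[symmetric, where N = M]) (use abc N NM omult_bicommutant van in auto)
  finally show "omult (omult a b) c v $$ n = omult a (omult b c) v $$ n" .
qed

lemma omult_vac:
  assumes "a \<in> bicommutant"
  shows "omult vac a = a"
proof (intro ext fls_eqI)
  fix v n
  obtain N where N: "vanish_below vac v N" "vanish_below a v N" by (rule vanish_below_common2)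
  \<comment> \<open>Only \<open>j = n\<close> contributes, and it need not lie in
    \<open>{N..n - N}\<close>.\<close>
  have "omult vac a v $$ n = (\<Sum>j\<in>insert n {N..n - N}. vac (a v $$ j) $$ (n - j))"
    by (rule omult_bicommutant_nth[OF vac_bicommutant assms N]) auto
  also have "\<dots> = (\<Sum>j\<in>insert n {N..n - N}. if j = n then a v $$ j else 0)"
    by (intro sum.cong refl) (simp add: vac_def)
  also have "\<dots> = a v $$ n" by (subst sum.delta) auto
  finally show "omult vac a v $$ n = a v $$ n" .
qed

lemma omult_add_left:
  assumes abc: "a \<in> bicommutant" "b \<in> bicommutant" "c \<in> bicommutant"
  shows "omult (a + b) c = omult a c + omult b c"
proof (intro ext fls_eqI)
  fix v n
  obtain N where N: "vanish_below a v N" "vanish_below b v N" "vanish_below c v N" by (rule vanish_below_common3)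
  then have "vanish_below (a + b) v N" by (simp add: vanish_below_def)
  with N show "omult (a + b) c v $$ n = (omult a c + omult b c) v $$ n"
    using omult_bicommutant_nth[OF _ abc(3) _ N(3), of _ "{N..n - N}" n]
    by (simp add: abc add_bicommutant sum.distrib)
qed

lemma omult_scaleH_left:
  assumes "a \<in> bicommutant" "b \<in> bicommutant"
  shows "omult (scaleH c a) b = scaleH c (omult a b)"
proof (intro ext fls_eqI)
  fix v n
  obtain N where N: "vanish_below a v N" "vanish_below b v N" by (rule vanish_below_common2)
  then have "vanish_below (scaleH c a) v N" by (simp add: vanish_below_def scaleH_nth_cst)
  with N show "omult (scaleH c a) b v $$ n = scaleH c (omult a b) v $$ n"
    using omult_bicommutant_nth[OF _ assms(2) _ N(2), of _ "{N..n - N}" n]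
    by (simp add: assms scaleH_bicommutant scaleH_nth_cst sum_distrib_left)
qed

lemma oderiv_omult:
  assumes "a \<in> bicommutant" "b \<in> bicommutant"
  shows "oderiv (omult a b) = omult (oderiv a) b + omult a (oderiv b)"
proof (intro ext fls_eqI)
  fix v n
  obtain N where N: "vanish_below a v N" "vanish_below b v N" by (rule vanish_below_common2)
  have d: "vanish_below (oderiv p) v (N - 1)" "vanish_below p v (N - 1)" if "vanish_below p v N" for p
    using that by (simp_all add: vanish_below_def oderiv_nth)
  let ?J = "{N - 1..n + 1 - (N - 1)}"
  have lin: "linL (\<lambda>v. a v $$ n)" for n by (rule linO_D[OF bicommutant_linO[OF assms(1)]])
  have 1: "omult (oderiv a) b v $$ n = (\<Sum>j\<in>?J. oderiv a (b v $$ j) $$ (n - j))"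
    by (rule omult_bicommutant_nth[where N = "N - 1"]) (use assms N d oderiv_bicommutant in auto)
  \<comment> \<open>One extra index at the lower end makes the shift \<open>j + 1\<close> map this
    range onto \<open>?J\<close>.\<close>
  have "omult a (oderiv b) v $$ n = (\<Sum>j\<in>{N - 2..n - (N - 1)}. a (oderiv b v $$ j) $$ (n - j))"
    by (rule omult_bicommutant_nth[where N = "N - 1"]) (use assms N d oderiv_bicommutant in auto)
  also have "\<dots> = (\<Sum>j\<in>?J. of_int j * a (b v $$ j) $$ (n + 1 - j))"
    by (rule sum.reindex_bij_witness[of _ "\<lambda>j. j - 1" "\<lambda>j. j + 1"])
      (auto simp: oderiv_nth linL_of_int[OF lin] simp del: of_int_add)
  finally have 2: "omult a (oderiv b) v $$ n = (\<Sum>j\<in>?J. of_int j * a (b v $$ j) $$ (n + 1 - j))" .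
  have "oderiv (omult a b) v $$ n = of_int (n + 1) * (\<Sum>j\<in>?J. a (b v $$ j) $$ (n + 1 - j))"
    unfolding oderiv_nth
    by (subst omult_bicommutant_nth[OF assms N, of ?J]) auto
  \<comment> \<open>Leibniz rule from \<open>n + 1 = (n + 1 - j) + j\<close>.\<close>
  also have "\<dots> = omult (oderiv a) b v $$ n + omult a (oderiv b) v $$ n"
    unfolding 1 2 oderiv_nth sum_distrib_left sum.distrib[symmetric]
    by (intro sum.cong refl) (simp add: algebra_simps)
  finally show "oderiv (omult a b) v $$ n = (omult (oderiv a) b + omult a (oderiv b)) v $$ n" by simp
qed

text \<open>As a type of class \<open>comm_ring_1\<close>, the ring admits products over lists and
  multisets and formal power series.\<close>

typedef vfield = bicommutant
  using vac_bicommutant by blast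

setup_lifting type_definition_vfield

instantiation vfield :: comm_ring_1
begin

lift_definition zero_vfield :: vfield is 0 by (rule zero_bicommutant)
lift_definition one_vfield :: vfield is vac by (rule vac_bicommutant)
lift_definition plus_vfield :: "vfield \<Rightarrow> vfield \<Rightarrow> vfield" is "(+)" by (rule add_bicommutant)
lift_definition minus_vfield :: "vfield \<Rightarrow> vfield \<Rightarrow> vfield" is "(-)" by (rule diff_bicommutant)
lift_definition uminus_vfield :: "vfield \<Rightarrow> vfield" is uminus by (rule uminus_bicommutant)
lift_definition times_vfield :: "vfield \<Rightarrow> vfield \<Rightarrow> vfield" is omult by (rule omult_bicommutant)

instance
proof
  fix a b c :: vfield
  show "a * b * c = a * (b * c)" by transfer (rule omult_assoc)
  show "a * b = b * a" by transfer (rule omult_commute)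
  show "1 * a = a" by transfer (rule omult_vac)
  show "(a + b) * c = a * c + b * c" by transfer (rule omult_add_left)
  show "a + b + c = a + (b + c)" by transfer (simp add: add.assoc)
  show "a + b = b + a" by transfer (simp add: add.commute)
  show "0 + a = a" by transfer simp
  show "- a + a = 0" by transfer simp
  show "a - b = a + - b" by transfer simp
  show "(0 :: vfield) \<noteq> 1"
  proof transfer
    have "vac 1 $$ 0 = (1 :: L0)" by (simp add: vac_def)
    then show "0 \<noteq> vac" by (metis zero_fun_apply fls_zero_nth zero_neq_one)
  qed
qed

end

lift_definition scaleV :: "F \<Rightarrow> vfield \<Rightarrow> vfield" is scaleH by (rule scaleH_bicommutant)
lift_definition derivV :: "vfield \<Rightarrow> vfield" is oderiv by (rule oderiv_bicommutant)
lift_definition xV :: vfield is x_hat by (rule x_hat_bicommutant)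

interpretation vf: vector_space scaleV
  by unfold_locales
    (transfer; simp add: hom.scale_right_distrib hom.scale_left_distrib)+

lemma scaleV_mult: "scaleV c a * b = scaleV c (a * b)"
  by transfer (rule omult_scaleH_left)

lemma derivV_mult: "derivV (a * b) = derivV a * b + a * derivV b"
  by transfer (rule oderiv_omult)

lemma derivV_add: "derivV (a + b) = derivV a + derivV b"
  by transfer (intro ext fls_eqI, simp add: oderiv_nth algebra_simps)

lemma derivV_scale: "derivV (scaleV c a) = scaleV c (derivV a)"
  by transfer (intro ext fls_eqI, simp add: oderiv_nth scaleH_nth_cst algebra_simps)

lemma xV_square: "xV * xV = 0"
  by transfer (rule x_hat_square)

section \<open>Straightening monomials\<close>

abbreviation gap2 :: "nat list \<Rightarrow> bool"
  where "gap2 \<equiv> sorted_wrt (\<lambda>a b. a + 2 \<le> b)"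

lemma sorted_not_gap2:
  "sorted ns \<Longrightarrow> \<not> gap2 ns \<Longrightarrow> \<exists>a b M. (b = a \<or> b = a + 1) \<and> mset ns = {#a, b#} + M"
proof (induction ns)
  case (Cons x xs)
  show ?case
  proof (cases "gap2 xs")
    case True
    then obtain z where z: "z \<in> set xs" "\<not> x + 2 \<le> z" using Cons.prems by auto
    then have "z = x \<or> z = x + 1" using Cons.prems by fastforce
    moreover have "mset (x # xs) = {#x, z#} + (mset xs - {#z#})" using z by simp
    ultimately show ?thesis by blast
  next
    case False
    then obtain a b M where "b = a \<or> b = a + 1" "mset xs = {#a, b#} + M" using Cons by auto
    then show ?thesis by (intro exI[of _ a] exI[of _ b] exI[of _ "add_mset x M"]) auto
  qed
qed simp

text \<open>At fixed total, \<open>a\<close> and \<open>b\<close> form the most balanced pair, and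
  moving the entries apart increases the sum of squares.\<close>

lemma sum_squares_spread:
  fixes a b i j :: nat
  assumes "b = a \<or> b = a + 1" "i + j = a + b" "i \<noteq> a" "i \<noteq> b"
  shows "a ^ 2 + b ^ 2 < i ^ 2 + j ^ 2"
proof -
  have main: "a ^ 2 + b ^ 2 < i ^ 2 + j ^ 2" if "i < a" "i + j = a + b" for i j
  proof -
    define k where "k = a - i"
    have k: "a = i + k" "k > 0" using that(1) by (simp_all add: k_def)
    then have j: "j = b + k" using that by simp
    have "i < b" using that assms(1) by auto
    then have "i * k < b * k" using k by simp
    then show ?thesis unfolding k(1) j power2_sum mult.assoc by linarith
  qed
  show ?thesis
  proof (cases "i < a")
    case True
    then show ?thesis using main assms by blast
  next
    case False
    then have "j < a" using assms by auto
    then show ?thesis using main[of j i] assms(2) by (simp add: add.commute)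
  qed
qed

lemma sum_mset_squares_le: "(\<Sum>n\<in>#M. n ^ 2) \<le> (sum_mset M) ^ 2" for M :: "nat multiset"
proof (induction M)
  case (add x M)
  then show ?case by (simp add: power2_eq_square algebra_simps)
qed simp

locale square_zero_sequence = vector_space scale
  for scale :: "'f :: field_char_0 \<Rightarrow> 'a :: comm_ring_1 \<Rightarrow> 'a" +
  fixes y :: "nat \<Rightarrow> 'a"
  assumes scale_mult: "scale c a * b = scale c (a * b)"
    and square_zero: "(\<Sum>i\<le>n. y i * y (n - i)) = 0"
begin

definition y_mono :: "nat multiset \<Rightarrow> 'a"
  where "y_mono M = (\<Prod>n\<in>#M. y n)"

definition gap_monos :: "'a set"
  where "gap_monos = {prod_list (map y ns) | ns. gap2 ns}"

lemma y_mono_mset: "y_mono (mset ns) = prod_list (map y ns)"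
  by (simp add: y_mono_def prod_mset_prod_list flip: mset_map)

text \<open>Solve the quadratic relation of degree \<open>a + b\<close> for its most balanced term.
  That term occurs once if \<open>b = a\<close> and twice otherwise, so \<open>c\<close> is
  \<open>-1\<close> or \<open>-1/2\<close>.\<close>

lemma pair_straighten:
  assumes ab: "b = a \<or> b = a + 1"
  shows "\<exists>c. y a * y b = scale c (\<Sum>i\<in>{..a + b} - {a, b}. y i * y (a + b - i))"
proof -
  let ?S = "\<Sum>i\<in>{..a + b} - {a, b}. y i * y (a + b - i)"
  have "(\<Sum>i\<le>a + b. y i * y (a + b - i)) = ?S + (\<Sum>i\<in>{a, b}. y i * y (a + b - i))"
    by (rule sum.subset_diff) auto
  then have eq: "(\<Sum>i\<in>{a, b}. y i * y (a + b - i)) = - ?S"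
    using square_zero[of "a + b"] by (simp add: eq_neg_iff_add_eq_0 add.commute)
  show ?thesis
  proof (cases "b = a")
    case True
    then have "y a * y b = scale (- 1) ?S" using eq by simp
    then show ?thesis by blast
  next
    case False
    have "scale 2 (y a * y b) = y a * y b + y a * y b"
      using scale_left_distrib[of 1 1 "y a * y b"] by simp
    also have "\<dots> = - ?S" using eq False by (simp add: mult.commute)
    finally have "scale (1 / 2) (scale 2 (y a * y b)) = scale (1 / 2) (- ?S)" by simp
    then have "y a * y b = scale (- 1 / 2) ?S" by simp
    then show ?thesis by blast
  qed
qed

text \<open>Straightening keeps the sum of the indices and raises the sum of squares, which the
  square of the sum bounds; the difference is therefore a terminating measure.\<close>

lemma y_mono_in_span_gap_monos: "y_mono M \<in> span gap_monos"
proof (induction "(sum_mset M) ^ 2 - (\<Sum>n\<in>#M. n ^ 2)" arbitrary: M rule: less_induct)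
  case less
  define ns where "ns = sorted_list_of_multiset M"
  have M: "M = mset ns" and sorted: "sorted ns" by (simp_all add: ns_def)
  show ?case
  proof (cases "gap2 ns")
    case True
    then have "y_mono M \<in> gap_monos" by (auto simp: M y_mono_mset gap_monos_def)
    then show ?thesis by (rule span_base)
  next
    case False
    then obtain a b M' where ab: "b = a \<or> b = a + 1" and M': "M = {#a, b#} + M'"
      using sorted_not_gap2[OF sorted] M by auto
    obtain c where c: "y a * y b = scale c (\<Sum>i\<in>{..a + b} - {a, b}. y i * y (a + b - i))"
      using pair_straighten[OF ab] by blast
    have "y_mono M = y a * y b * y_mono M'" by (simp add: M' y_mono_def mult.assoc)
    also have "\<dots> = scale c (\<Sum>i\<in>{..a + b} - {a, b}. y_mono ({#i, a + b - i#} + M'))"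
      by (simp add: c scale_mult sum_distrib_right y_mono_def mult.assoc)
    also have "\<dots> \<in> span gap_monos"
    proof (intro span_scale span_sum less)
      fix i assume i: "i \<in> {..a + b} - {a, b}"
      let ?M = "{#i, a + b - i#} + M'"
      have "i + (a + b - i) = a + b" using i by auto
      then have "a ^ 2 + b ^ 2 < i ^ 2 + (a + b - i) ^ 2" using sum_squares_spread[OF ab] i by auto
      then have "(\<Sum>n\<in>#M. n ^ 2) < (\<Sum>n\<in>#?M. n ^ 2)" by (simp add: M')
      moreover have "sum_mset ?M = sum_mset M" using i by (simp add: M')
      ultimately show "(sum_mset ?M) ^ 2 - (\<Sum>n\<in>#?M. n ^ 2) < (sum_mset M) ^ 2 - (\<Sum>n\<in>#M. n ^ 2)"
        using sum_mset_squares_le[of ?M] by simp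
    qed
    finally show ?thesis .
  qed
qed

lemma span_monos: "span (range y_mono) = span gap_monos"
proof (rule span_eq[THEN iffD2], intro conjI subsetI)
  show "a \<in> span gap_monos" if "a \<in> range y_mono" for a
    using that y_mono_in_span_gap_monos by auto
  show "a \<in> span (range y_mono)" if "a \<in> gap_monos" for a
  proof -
    from that obtain ns where "a = y_mono (mset ns)" by (auto simp: gap_monos_def y_mono_mset)
    then show ?thesis by (auto intro: span_base)
  qed
qed

lemma span_monos_mult:
  assumes "a \<in> span (range y_mono)" "b \<in> span (range y_mono)"
  shows "a * b \<in> span (range y_mono)"
proof -
  have 1: "a * y_mono M \<in> span (range y_mono)" for M
    using assms(1)
  proof (induction rule: span_induct_alt)
    case (step c u v)
    then obtain L where "u = y_mono L" by auto
    then have "u * y_mono M = y_mono (L + M)" by (simp add: y_mono_def)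
    then have "scale c u * y_mono M \<in> span (range y_mono)" by (simp add: scale_mult span_scale span_base)
    then show ?case using step by (simp add: distrib_right span_add)
  qed (simp add: span_zero)
  show ?thesis
    using assms(2)
  proof (induction rule: span_induct_alt)
    case (step c u v)
    then obtain L where "u = y_mono L" by auto
    then have "a * scale c u \<in> span (range y_mono)"
      using 1[of L] scale_mult[of c u a] by (simp add: mult.commute span_scale)
    then show ?case using step by (simp add: distrib_left span_add)
  qed (simp add: span_zero)
qed

end

section \<open>\<open>W\<^sub>0\<close> as a ring of operators\<close>

definition yV :: "nat \<Rightarrow> vfield"
  where "yV n = scaleV (1 / fact n) ((derivV ^^ n) xV)"

lemma scaleV_of_nat: "scaleV (of_nat n) a = of_nat n * a"
  by (induction n) (simp_all add: vf.scale_left_distrib distrib_right)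

lemma derivV_yV: "derivV (yV n) = of_nat (Suc n) * yV (Suc n)"
proof -
  have "(1 / fact n :: F) = of_nat (Suc n) * (1 / fact (Suc n))"
    by (simp add: fact_Suc del: of_nat_Suc)
  then show ?thesis
    by (simp only: yV_def derivV_scale funpow.simps comp_apply vf.scale_scale scaleV_of_nat[symmetric])
qed

lemma derivV_0: "derivV 0 = 0"
  using derivV_add[of 0 0] by simp

lemma derivV_1: "derivV 1 = 0"
  using derivV_mult[of 1 1] by simp

lemma derivV_sum: "derivV (sum f I) = (\<Sum>i\<in>I. derivV (f i))"
  by (induction I rule: infinite_finite_induct) (simp_all add: derivV_0 derivV_add)

text \<open>\<open>Abs_fps yV\<close> is the Taylor series of \<open>x_hat(z + z0)\<close> in
  \<open>z0\<close>. On its coefficients \<open>derivV\<close> acts as the derivative in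
  \<open>z0\<close>, which propagates \<open>xV * xV = 0\<close> to all coefficients of the
  square.\<close>

lemma yV_square_zero: "(\<Sum>i\<le>n. yV i * yV (n - i)) = 0"
proof -
  define Y where "Y = Abs_fps yV"
  have Dn: "derivV (Y $ i) = fps_deriv Y $ i" for i
    by (simp add: Y_def derivV_yV)
  have D: "derivV ((Y * Y) $ n) = fps_deriv (Y * Y) $ n" for n
    unfolding fps_deriv_mult fps_add_nth fps_mult_nth derivV_sum derivV_mult Dn sum.distrib
    by (rule add.commute)
  have "(Y * Y) $ n = 0" for n
  proof (induction n)
    case 0
    show ?case by (simp add: Y_def yV_def xV_square)
  next
    case (Suc n)
    have "scaleV (of_nat (Suc n)) ((Y * Y) $ Suc n) = 0"
      using D[of n] by (simp only: Suc derivV_0 scaleV_of_nat fps_deriv_nth Suc_eq_plus1)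
    then show ?case by (simp del: of_nat_Suc)
  qed
  then show ?thesis by (simp add: fps_mult_nth Y_def atLeast0AtMost)
qed

interpretation sq: square_zero_sequence scaleV yV
  by unfold_locales (rule scaleV_mult yV_square_zero)+

lemma y_mono_add_mset: "sq.y_mono (add_mset n M) = yV n * sq.y_mono M"
  by (simp add: sq.y_mono_def)

text \<open>Its image under \<open>Rep_vfield\<close> will be \<open>W0\<close>. Taking all
  monomials makes closure under products visible.\<close>

abbreviation WV :: "vfield set"
  where "WV \<equiv> vf.span (range sq.y_mono)"

lemma mono_WV: "sq.y_mono M \<in> WV"
  by (auto intro: vf.span_base)

lemma yV_WV: "yV n \<in> WV"
  using mono_WV[of "{#n#}"] by (simp add: sq.y_mono_def)

lemma derivV_WV: "a \<in> WV \<Longrightarrow> derivV a \<in> WV"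
proof (induction rule: vf.span_induct_alt)
  case base
  show ?case by (simp add: derivV_0 vf.span_zero)
next
  case (step c u v)
  have "derivV (sq.y_mono M) \<in> WV" for M
  proof (induction M)
    case empty
    show ?case by (simp add: sq.y_mono_def derivV_1 vf.span_zero)
  next
    case (add n M)
    have "scaleV (of_nat (Suc n)) (yV (Suc n)) \<in> WV" by (intro vf.span_scale yV_WV)
    then have y: "of_nat (Suc n) * yV (Suc n) \<in> WV" unfolding scaleV_of_nat .
    show ?case
      unfolding y_mono_add_mset derivV_mult derivV_yV
      by (intro vf.span_add sq.span_monos_mult[OF y mono_WV] sq.span_monos_mult[OF yV_WV add])
  qed
  with step show ?case by (auto simp: derivV_add derivV_scale intro: vf.span_add vf.span_scale)
qed

lemma Rep_nprod:
  "nprod (Rep_vfield a) r (Rep_vfield b) =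
    Rep_vfield (if r \<ge> 0 then 0 else scaleV (1 / fact (nat (- r - 1))) ((derivV ^^ nat (- r - 1)) a * b))"
proof -
  have D: "(oderiv ^^ n) (Rep_vfield a) = Rep_vfield ((derivV ^^ n) a)" for n
    by (induction n) (simp_all add: derivV.rep_eq)
  show ?thesis
    by (simp add: nprod_def D scaleV.rep_eq times_vfield.rep_eq zero_vfield.rep_eq)
qed

lemma Rep_nprod_x_hat:
  "nprod x_hat (- int n - 1) (Rep_vfield b) = Rep_vfield (yV n * b)"
  using Rep_nprod[of xV "- int n - 1" b] by (simp add: xV.rep_eq yV_def scaleV_mult)

text \<open>\<open>fold\<close> lets the head act first while the product puts it outermost;
  commutativity reconciles the two orders.\<close>

lemma monomial_Rep:
  "monomial (map (\<lambda>n. - int n - 1) ns) = Rep_vfield (prod_list (map yV ns))"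
proof -
  have "fold (nprod x_hat) (map (\<lambda>n. - int n - 1) ns) (Rep_vfield b) = Rep_vfield (prod_list (map yV ns) * b)" for b
    by (induction ns arbitrary: b) (simp_all add: Rep_nprod_x_hat ac_simps)
  from this[of 1] show ?thesis by (simp add: monomial_def one_vfield.rep_eq)
qed

text \<open>Dictionary \<open>l = - n - 1\<close> between product indices and derivative orders; it
  turns the steps of at least 2 downwards into gaps of at least 2 upwards.\<close>

lemma admissible_iff: "admissible ls \<longleftrightarrow> (\<exists>ns. ls = map (\<lambda>n. - int n - 1) ns \<and> gap2 ns)"
proof
  have tr: "transp (\<lambda>a b :: nat. a + 2 \<le> b)" by (auto simp: transp_def)
  {
    assume adm: "admissible ls"
    define ns where "ns = map (\<lambda>l. nat (- l - 1)) ls"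
    \<comment> \<open>Negativity ensures that \<open>nat (- l - 1)\<close> loses no
      information.\<close>
    have neg: "ls ! i < 0" if "i < length ls" for i
      using that
    proof (induction i)
      case 0
      then show ?case using adm by (auto simp: admissible_def)
    next
      case (Suc i)
      then have "ls ! Suc i \<le> ls ! i - 2" using adm by (auto simp: admissible_def)
      then show ?case using Suc by simp
    qed
    have "ls = map (\<lambda>n. - int n - 1) ns"
      by (rule nth_equalityI) (use neg in \<open>auto simp: ns_def\<close>)
    moreover have "gap2 ns"
      unfolding sorted_wrt_iff_nth_Suc_transp[OF tr]
    proof (intro allI impI)
      fix i assume i: "Suc i < length ns"
      then have "ls ! Suc i \<le> ls ! i - 2" using adm by (auto simp: admissible_def ns_def)
      moreover have "int (ns ! j) = - ls ! j - 1" if "j < length ns" for j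
        using neg[of j] that by (simp add: ns_def)
      from this[of i] this[of "Suc i"] have "int (ns ! i) = - ls ! i - 1" "int (ns ! Suc i) = - ls ! Suc i - 1"
        using i by simp_all
      ultimately show "ns ! i + 2 \<le> ns ! Suc i" by linarith
    qed
    ultimately show "\<exists>ns. ls = map (\<lambda>n. - int n - 1) ns \<and> gap2 ns" by blast
  next
    assume "\<exists>ns. ls = map (\<lambda>n. - int n - 1) ns \<and> gap2 ns"
    then obtain ns where ns: "ls = map (\<lambda>n. - int n - 1) ns" "gap2 ns" by blast
    then have "ns ! i + 2 \<le> ns ! Suc i" if "Suc i < length ns" for i
      using that unfolding sorted_wrt_iff_nth_Suc_transp[OF tr] by blast
    then show "admissible ls" by (force simp: admissible_def ns(1))
  }
qed

lemma B_W0_Rep: "B_W0 = Rep_vfield ` sq.gap_monos"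
proof -
  have "B_W0 = {monomial (map (\<lambda>n. - int n - 1) ns) | ns. gap2 ns}"
    unfolding B_W0_def admissible_iff by blast
  then show ?thesis unfolding monomial_Rep sq.gap_monos_def by blast
qed

lemma module_hom_Rep: "module_hom scaleV scaleH Rep_vfield"
  by unfold_locales (simp_all add: plus_vfield.rep_eq scaleV.rep_eq)

lemma span_B_W0_Rep: "hom.span B_W0 = Rep_vfield ` WV"
  using module_hom.span_image[OF module_hom_Rep, of sq.gap_monos] by (simp add: B_W0_Rep sq.span_monos)

text \<open>The image of \<open>WV\<close> contains the two generators and is stable under all
  closure rules of \<open>W0\<close>; conversely, every monomial is an iterated product in
  \<open>W0\<close>.\<close>

lemma span_B_W0: "hom.span B_W0 = W0"
proof
  have sub: "hom.subspace W0"
    unfolding hom.subspace_def using W0.add W0.scale W0.scale[OF W0.vac, of 0] by auto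
  have "fold (nprod x_hat) ls a \<in> W0" if "a \<in> W0" for ls a
    using that by (induction ls arbitrary: a) (simp_all add: W0.nprod W0.x_hat)
  then have "B_W0 \<subseteq> W0" by (auto simp: B_W0_def monomial_def W0.vac)
  then show "hom.span B_W0 \<subseteq> W0" using sub by (rule hom.span_minimal)
  show "W0 \<subseteq> hom.span B_W0"
    unfolding span_B_W0_Rep
  proof
    fix a assume "a \<in> W0"
    then show "a \<in> Rep_vfield ` WV"
    proof induction
      case vac
      have "1 \<in> WV" using mono_WV[of "{#}"] by (simp add: sq.y_mono_def)
      then show ?case by (force simp: one_vfield.rep_eq)
    next
      case x_hat
      have "xV \<in> WV" using yV_WV[of 0] by (simp add: yV_def)
      then show ?case by (force simp: xV.rep_eq)
    next
      case (add a b)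
      then obtain a' b' where "a = Rep_vfield a'" "b = Rep_vfield b'" "a' \<in> WV" "b' \<in> WV" by blast
      then have "a + b = Rep_vfield (a' + b')" "a' + b' \<in> WV"
        by (auto simp: plus_vfield.rep_eq intro: vf.span_add)
      then show ?case by blast
    next
      case (scale a c)
      then obtain a' where "a = Rep_vfield a'" "a' \<in> WV" by blast
      then have "scaleH c a = Rep_vfield (scaleV c a')" "scaleV c a' \<in> WV"
        by (auto simp: scaleV.rep_eq intro: vf.span_scale)
      then show ?case by blast
    next
      case (nprod a b r)
      then obtain a' b' where ab: "a = Rep_vfield a'" "b = Rep_vfield b'" "a' \<in> WV" "b' \<in> WV" by blast
      have "(derivV ^^ n) a' \<in> WV" for n by (induction n) (use ab derivV_WV in auto)
      then have "(if r \<ge> 0 then 0 else scaleV (1 / fact (nat (- r - 1))) ((derivV ^^ nat (- r - 1)) a' * b')) \<in> WV"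
        using ab by (auto intro: vf.span_zero vf.span_scale sq.span_monos_mult)
      then show ?case unfolding ab(1,2) Rep_nprod by blast
    qed
  qed
qed

section \<open>Linear independence\<close>

definition Xs :: "int list \<Rightarrow> L0 \<Rightarrow> L0"
  where "Xs ks v = foldr X ks v"

lemma Xs_Nil [simp]: "Xs [] v = v" and Xs_Cons [simp]: "Xs (k # ks) v = X k (Xs ks v)"
  by (simp_all add: Xs_def)

lemma linL_Xs: "linL (Xs ks)"
  by (induction ks) (simp_all add: linL_def linL_add[OF linL_X] linL_cst[OF linL_X])

lemma Xs_X: "Xs ks (X k v) = X k (Xs ks v)"
  by (induction ks) (simp_all add: X_commute)

lemma X_one: "X k 1 = H $$ k * evec 1"
  using x_hat_evec[of 0 k] by simp

text \<open>A factor of negative index kills 1, and commutativity lets it act first.\<close>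

lemma Xs_negative: "k \<in> set ks \<Longrightarrow> k < 0 \<Longrightarrow> Xs ks 1 = 0"
proof (induction ks)
  case (Cons k' ks)
  show ?case
  proof (cases "k = k'")
    case True
    then have "Xs (k' # ks) 1 = Xs ks (X k 1)" by (simp add: Xs_X)
    also have "X k 1 = 0" using Cons.prems by (simp add: X_one H_nth)
    finally show ?thesis by (simp add: linL_0[OF linL_Xs])
  next
    case False
    then show ?thesis using Cons by (simp add: linL_0[OF linL_X])
  qed
qed simp

lemma Xs_evec_mult: "Xs ks (evec 1 * v) = evec 1 * Xs (map (\<lambda>k. k - 2) ks) v"
  by (induction ks) (simp_all add: X_evec_mult)

text \<open>Let \<open>X 0\<close> act first: it turns 1 into \<open>e^alpha\<close>, and pulling
  \<open>e^alpha\<close> out lowers the other indices by 2.\<close>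

lemma Xs_zero_Cons: "Xs (0 # map (\<lambda>k. k + 2) ks) 1 = evec 1 * Xs ks 1"
proof -
  have "Xs (0 # map (\<lambda>k. k + 2) ks) 1 = Xs (map (\<lambda>k. k + 2) ks) (evec 1 * 1)"
    by (simp add: X_one flip: Xs_X)
  also have "\<dots> = evec 1 * Xs ks 1" unfolding Xs_evec_mult by (simp add: comp_def)
  finally show ?thesis .
qed

text \<open>Moving \<open>R(w)\<close> to the vector 1 leaves a product of factors
  \<open>1 - z/w\<close>, one per index, of degree \<open>length ks\<close> in
  \<open>1/w\<close>.\<close>

lemma R_Xs_eq_0: "j > int (length ks) \<Longrightarrow> R j (Xs ks 1) = 0"
proof (induction ks arbitrary: j)
  case Nil
  then show ?case using R_evec[of j 0] by simp
next
  case (Cons k ks)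
  then show ?case by (simp add: R_X linL_0[OF linL_X])
qed

text \<open>The top coefficient of that product takes the term \<open>- z/w\<close> from every
  factor.\<close>

lemma R_Xs: "R (int (length ks)) (Xs ks 1) = (- 1) ^ length ks * Xs (map (\<lambda>k. k - 1) ks) 1"
proof (induction ks)
  case Nil
  then show ?case using R_evec[of 0 0] by simp
next
  case (Cons k ks)
  have "X k' ((- 1) ^ n * v) = (- 1) ^ n * X k' v" for k' n v
    by (cases "even n") (simp_all add: linL_uminus[OF linL_X])
  then show ?case using Cons by (simp add: R_X R_Xs_eq_0 linL_0[OF linL_X])
qed

lemma charge_Xs: "charge m (Xs ks 1) = (if m = int (length ks) then Xs ks 1 else 0)"
proof (induction ks arbitrary: m)
  case Nil
  then show ?case using charge_evec[of m 0] by auto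
next
  case (Cons k ks)
  show ?case using charge_X[of "m - 1" "Xs ks 1" k] Cons[of "m - 1"]
    by (auto simp: linL_0[OF linL_X])
qed

section \<open>Independence of the vectors with gaps\<close>

definition Xvec :: "nat list \<Rightarrow> L0"
  where "Xvec ns = Xs (map int ns) 1"

lemma gap2_hd_pos: "gap2 ns \<Longrightarrow> ns \<noteq> [] \<Longrightarrow> hd ns \<noteq> 0 \<Longrightarrow> \<exists>ms. ns = map Suc ms"
proof -
  assume ns: "gap2 ns" "ns \<noteq> []" "hd ns \<noteq> 0"
  then have "\<forall>n\<in>set ns. n \<noteq> 0" by (cases ns) auto
  then have "ns = map Suc (map (\<lambda>n. n - 1) ns)" by (induction ns) auto
  then show ?thesis by blast
qed

lemma gap2_hd_0: "gap2 (0 # ns) \<Longrightarrow> \<exists>ms. ns = map (\<lambda>n. n + 2) ms"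
proof -
  assume "gap2 (0 # ns)"
  then have "\<forall>n\<in>set ns. 2 \<le> n" by auto
  then have "ns = map (\<lambda>n. n + 2) (map (\<lambda>n. n - 2) ns)" by (induction ns) auto
  then show ?thesis by blast
qed

lemma Xvec_zero_Cons: "Xvec (0 # map (\<lambda>n. n + 2) ms) = evec 1 * Xvec ms"
  using Xs_zero_Cons[of "map int ms"] by (simp add: Xvec_def comp_def add.commute)

lemma R_Xvec:
  "R (int (length ns)) (Xvec ns) = (- 1) ^ length ns * Xs (map (\<lambda>n. int n - 1) ns) 1"
  using R_Xs[of "map int ns"] by (simp add: Xvec_def comp_def)

lemma R_Xvec_Suc: "length ms = m \<Longrightarrow> R (int m) (Xvec (map Suc ms)) = (- 1) ^ m * Xvec ms"
  using R_Xvec[of "map Suc ms"] by (simp add: comp_def Xvec_def)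

lemma R_Xvec_zero: "length ms = m \<Longrightarrow> R (int (Suc m)) (Xvec (0 # ms)) = 0"
  using R_Xvec[of "0 # ms"] Xs_negative[of "-1" "map (\<lambda>n. int n - 1) (0 # ms)"] by simp

lemma cst_eq_0: "cst c = 0 \<Longrightarrow> c = 0"
  using cst_cancel[of c 1 0] by auto

lemma evec_mult_eq_0: "evec 1 * v = 0 \<Longrightarrow> v = 0"
proof -
  assume "evec 1 * v = 0"
  then have "evec (- 1) * (evec 1 * v) = 0" by simp
  then show "v = 0" by (simp add: evec_mult flip: mult.assoc)
qed

text \<open>Outer induction on the length \<open>m\<close>, inner induction on the bound
  \<open>N\<close> for the smallest index: lists with positive head are treated by \<open>R\<close>,
  those with head 0 by removing \<open>e^alpha\<close>.\<close>

lemma Xvec_independent_hd_bound: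
  assumes "finite S" "\<And>ns. ns \<in> S \<Longrightarrow> gap2 ns \<and> length ns = m \<and> (ns \<noteq> [] \<longrightarrow> hd ns < N)"
    and "(\<Sum>ns\<in>S. cst (c ns) * Xvec ns) = 0" "ns \<in> S"
  shows "c ns = 0"
  using assms
proof (induction m arbitrary: N S c ns)
  case 0
  then have "S \<subseteq> {[]}" by auto
  then have "S = {[]}" "ns = []" using 0 by auto
  then show ?case using 0 by (auto simp: Xvec_def intro: cst_eq_0)
next
  case (Suc m)
  note outer = Suc.IH
  show ?case using Suc.prems
  proof (induction N arbitrary: S c ns)
    case 0
    have "ns \<noteq> []" using 0(2)[OF 0(4)] by auto
    then show ?case using 0(2)[OF 0(4)] by simp
  next
    case (Suc N)
    let ?z = "\<lambda>ms :: nat list. 0 # map (\<lambda>n. n + 2) ms"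
    \<comment> \<open>\<open>T1\<close> holds the lists with positive head, lowered by 1.
      \<open>T0\<close> holds the tails of those with head 0, lowered by 2, as the gap condition
      permits.\<close>
    define T1 where "T1 = map Suc -` S"
    define T0 where "T0 = ?z -` S"
    have inj1: "inj (map Suc)" by simp
    have "inj (map (\<lambda>n :: nat. n + 2))" by (intro inj_mapI injI) simp
    then have inj0: "inj ?z" by (auto simp: inj_def)
    have fin1: "finite T1" unfolding T1_def by (rule finite_vimageI[OF Suc.prems(1) inj1])
    have fin0: "finite T0" unfolding T0_def by (rule finite_vimageI[OF Suc.prems(1) inj0])
    have S: "S = map Suc ` T1 \<union> ?z ` T0"
    proof (intro equalityI subsetI)
      fix l assume l: "l \<in> S"
      then have g: "gap2 l" "length l = Suc m" using Suc.prems(2) by auto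
      show "l \<in> map Suc ` T1 \<union> ?z ` T0"
      proof (cases "hd l = 0")
        case True
        then have l0: "l = 0 # tl l" using g(2) by (cases l) auto
        then obtain ms where "tl l = map (\<lambda>n. n + 2) ms" using gap2_hd_0[of "tl l"] g(1) by metis
        then have "l = ?z ms" using l0 by simp
        then show ?thesis using l by (auto simp: T0_def)
      next
        case False
        then obtain ms where "l = map Suc ms" using gap2_hd_pos[OF g(1)] g(2) by fastforce
        then show ?thesis using l by (auto simp: T1_def)
      qed
    qed (auto simp: T1_def T0_def)
    have ne: "ms \<noteq> []" if "ms \<in> T1" for ms using Suc.prems(2)[of "map Suc ms"] that by (auto simp: T1_def)
    have disj: "map Suc ` T1 \<inter> ?z ` T0 = {}" using ne by auto
    have split: "(\<Sum>l\<in>S. f l) = (\<Sum>ms\<in>T1. f (map Suc ms)) + (\<Sum>ms\<in>T0. f (?z ms))" for f :: "nat list \<Rightarrow> L0"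
      unfolding S sum.union_disjoint[OF finite_imageI[OF fin1] finite_imageI[OF fin0] disj]
        sum.reindex[OF inj_on_subset[OF inj1 subset_UNIV]] sum.reindex[OF inj_on_subset[OF inj0 subset_UNIV]]
      by (simp only: comp_def)
    have len1: "length ms = Suc m" if "ms \<in> T1" for ms using Suc.prems(2)[of "map Suc ms"] that by (simp add: T1_def)
    have len0: "length ms = m" if "ms \<in> T0" for ms using Suc.prems(2)[of "?z ms"] that by (simp add: T0_def)
    \<comment> \<open>The top mode of \<open>R\<close> kills the lists with head 0, where the index
      \<open>-1\<close> appears, and lowers the others, so the inner hypothesis with bound
      \<open>N\<close> applies.\<close>
    have "0 = R (int (Suc m)) (\<Sum>l\<in>S. cst (c l) * Xvec l)"
      unfolding Suc.prems(3) by (simp add: linL_0[OF linL_R])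
    also have "\<dots> = (\<Sum>l\<in>S. cst (c l) * R (int (Suc m)) (Xvec l))"
      by (simp only: linL_sum[OF linL_R] linL_cst[OF linL_R])
    also have "\<dots> = (\<Sum>ms\<in>T1. cst (c (map Suc ms)) * ((- 1) ^ Suc m * Xvec ms))"
    proof -
      have "R (int (Suc m)) (Xvec (?z ms)) = 0" if "ms \<in> T0" for ms
        by (rule R_Xvec_zero) (simp add: len0[OF that])
      then have "(\<Sum>ms\<in>T0. cst (c (?z ms)) * R (int (Suc m)) (Xvec (?z ms))) = 0"
        by (intro sum.neutral) simp
      moreover have "(\<Sum>ms\<in>T1. cst (c (map Suc ms)) * R (int (Suc m)) (Xvec (map Suc ms))) =
          (\<Sum>ms\<in>T1. cst (c (map Suc ms)) * ((- 1) ^ Suc m * Xvec ms))"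
        by (intro sum.cong refl) (simp only: R_Xvec_Suc[OF len1])
      ultimately show ?thesis unfolding split by (simp only: add_0_right)
    qed
    also have "\<dots> = (- 1) ^ Suc m * (\<Sum>ms\<in>T1. cst (c (map Suc ms)) * Xvec ms)"
      unfolding sum_distrib_left by (intro sum.cong refl mult.left_commute)
    finally have sum1: "(\<Sum>ms\<in>T1. cst (c (map Suc ms)) * Xvec ms) = 0" by simp
    have c1: "c (map Suc ms) = 0" if "ms \<in> T1" for ms
    proof (rule Suc.IH[OF fin1 _ sum1 that])
      fix ms assume "ms \<in> T1"
      with Suc.prems(2)[of "map Suc ms"] show "gap2 ms \<and> length ms = Suc m \<and> (ms \<noteq> [] \<longrightarrow> hd ms < N)"
        by (auto simp: T1_def sorted_wrt_map hd_map)
    qed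
    \<comment> \<open>Only lists with head 0 are left, and \<open>evec 1\<close> is
      invertible.\<close>
    have "0 = (\<Sum>l\<in>S. cst (c l) * Xvec l)" using Suc.prems(3) by simp
    also have "\<dots> = (\<Sum>ms\<in>T0. cst (c (?z ms)) * (evec 1 * Xvec ms))"
      unfolding split Xvec_zero_Cons by (simp add: c1)
    also have "\<dots> = evec 1 * (\<Sum>ms\<in>T0. cst (c (?z ms)) * Xvec ms)"
      unfolding sum_distrib_left by (intro sum.cong refl mult.left_commute)
    finally have sum0: "(\<Sum>ms\<in>T0. cst (c (?z ms)) * Xvec ms) = 0"
      by (rule evec_mult_eq_0[OF sym])
    have c0: "c (?z ms) = 0" if "ms \<in> T0" for ms
    proof (rule outer[OF fin0 _ sum0 that])
      fix ms assume ms: "ms \<in> T0"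
      \<comment> \<open>The outer hypothesis accepts any bound on the heads; finiteness of
        \<open>T0\<close> supplies this one.\<close>
      have "hd ms < Suc (\<Sum>ms\<in>T0. hd ms)" using member_le_sum[OF ms _ fin0, of hd] by simp
      then show "gap2 ms \<and> length ms = m \<and> (ms \<noteq> [] \<longrightarrow> hd ms < Suc (\<Sum>ms\<in>T0. hd ms))"
        using Suc.prems(2)[of "?z ms"] ms by (auto simp: T0_def sorted_wrt_map)
    qed
    from Suc.prems(4) have "ns \<in> map Suc ` T1 \<or> ns \<in> ?z ` T0" unfolding S by (rule UnE) simp_all
    then show ?case by (elim disjE imageE) (simp_all only: c0 c1)
  qed
qed

text \<open>The power of \<open>e^alpha\<close> records the length, so projecting by
  \<open>charge\<close> reduces to lists of one length.\<close>

lemma Xvec_independent: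
  assumes fin: "finite S" and gap: "\<And>ns. ns \<in> S \<Longrightarrow> gap2 ns"
    and sum: "(\<Sum>ns\<in>S. cst (c ns) * Xvec ns) = 0" and ns: "ns \<in> S"
  shows "c ns = 0"
proof -
  let ?S = "{l \<in> S. length l = length ns}"
  have "0 = charge (int (length ns)) (\<Sum>l\<in>S. cst (c l) * Xvec l)"
    unfolding sum by (simp add: linL_0[OF linL_charge])
  also have "\<dots> = (\<Sum>l\<in>S. cst (c l) * charge (int (length ns)) (Xvec l))"
    by (simp only: linL_sum[OF linL_charge] linL_cst[OF linL_charge])
  also have "\<dots> = (\<Sum>l\<in>S. if length l = length ns then cst (c l) * Xvec l else 0)"
    by (intro sum.cong refl) (simp add: Xvec_def charge_Xs)
  also have "\<dots> = (\<Sum>l\<in>?S. cst (c l) * Xvec l)"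
    using fin by (simp add: sum.inter_filter)
  finally have sum': "(\<Sum>l\<in>?S. cst (c l) * Xvec l) = 0" by simp
  have fin': "finite ?S" using fin by simp
  show ?thesis
  proof (rule Xvec_independent_hd_bound[OF fin' _ sum'])
    fix l assume l: "l \<in> ?S"
    have "hd l < Suc (\<Sum>l\<in>?S. hd l)" using member_le_sum[OF l _ fin', of hd] by simp
    then show "gap2 l \<and> length l = length ns \<and> (l \<noteq> [] \<longrightarrow> hd l < Suc (\<Sum>l\<in>?S. hd l))"
      using l gap by simp
  qed (use ns in simp)
qed

section \<open>From operators to vectors\<close>

lemma oderiv_funpow_nth: "(oderiv ^^ n) a v $$ k = of_int (pochhammer (k + 1) n) * a v $$ (k + int n)"
proof (induction n arbitrary: k)
  case (Suc n)
  have "(oderiv ^^ Suc n) a v $$ k = of_int (k + 1) * (of_int (pochhammer (k + 1 + 1) n) * a v $$ (k + 1 + int n))"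
    by (simp add: oderiv_nth Suc)
  also have "\<dots> = of_int (pochhammer (k + 1) (Suc n)) * a v $$ (k + int (Suc n))"
    by (simp add: pochhammer_rec ac_simps)
  finally show ?case .
qed simp

lemma yV_nth: "Rep_vfield (yV n) v $$ k = cst (1 / fact n) * of_int (pochhammer (k + 1) n) * X (k + int n) v"
proof -
  have "(oderiv ^^ n) x_hat = Rep_vfield ((derivV ^^ n) xV)" for n
    by (induction n) (simp_all add: derivV.rep_eq xV.rep_eq)
  then show ?thesis
    using oderiv_funpow_nth[of n x_hat v k] by (simp add: yV_def scaleV.rep_eq scaleH_nth_cst mult.assoc)
qed

lemma yV_mode_0: "Rep_vfield (yV n) v $$ 0 = X (int n) v"
proof -
  have "cst (1 / fact n) * of_int (pochhammer 1 n) = cst (1 / fact n * fact n)"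
    using cst_of_nat[of "fact n"] by (simp only: cst_mult of_nat_fact of_int_fact flip: pochhammer_fact)
  then show ?thesis by (simp add: yV_nth)
qed

text \<open>For \<open>k + n < 0\<close> the mode of \<open>x_hat\<close> kills 1; for
  \<open>-n \<le> k < 0\<close> the Pochhammer factor \<open>(k+1)...(k+n)\<close> contains
  0.\<close>

lemma yV_vanish_below: "vanish_below (Rep_vfield (yV n)) 1 0"
  unfolding vanish_below_def
proof (intro allI impI)
  fix k :: int assume k: "k < 0"
  show "Rep_vfield (yV n) 1 $$ k = 0"
  proof (cases "k + int n < 0")
    case True
    then show ?thesis by (simp add: yV_nth X_one H_nth)
  next
    case False
    then have "pochhammer (k + 1) n = 0"
      using pochhammer_of_nat_eq_0_iff[of "nat (- k - 1)" n, where 'a = int] k by (simp add: add.commute)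
    then show ?thesis by (simp add: yV_nth)
  qed
qed

lemma prod_yV_vanish_below: "vanish_below (Rep_vfield (prod_list (map yV ns))) 1 0"
proof (induction ns)
  case Nil
  show ?case by (simp add: vanish_below_def one_vfield.rep_eq vac_def)
next
  case (Cons n ns)
  show ?case
    using omult_bicommutant_nth[OF Rep_vfield Rep_vfield yV_vanish_below Cons, of "{}"]
    by (simp add: vanish_below_def times_vfield.rep_eq)
qed

text \<open>On products of the \<open>yV n\<close> only non-negative powers of \<open>z\<close> occur in the image of the vector \<open>1\<close>,
  so that passing to the constant coefficient is multiplicative.\<close>

lemma prod_yV_mode_0: "Rep_vfield (prod_list (map yV ns)) 1 $$ 0 = Xvec ns"
proof (induction ns)
  case Nil
  show ?case by (simp add: one_vfield.rep_eq vac_def Xvec_def)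
next
  case (Cons n ns)
  \<comment> \<open>With lower bound 0 on both factors, only \<open>j = 0\<close> contributes to the
    constant coefficient.\<close>
  have "omult (Rep_vfield (yV n)) (Rep_vfield (prod_list (map yV ns))) 1 $$ 0 =
      Rep_vfield (yV n) (Rep_vfield (prod_list (map yV ns)) 1 $$ 0) $$ 0"
    using omult_bicommutant_nth[OF Rep_vfield Rep_vfield yV_vanish_below prod_yV_vanish_below, of "{0}" 0] by simp
  then show ?case by (simp add: times_vfield.rep_eq Cons yV_mode_0) (simp add: Xvec_def)
qed

lemma independent_B_W0: "hom.independent B_W0"
  unfolding hom.dependent_explicit
proof clarify
  fix t u b
  assume t: "finite t" "t \<subseteq> B_W0" and sum: "(\<Sum>v\<in>t. scaleH (u v) v) = 0" and b: "b \<in> t" "u b \<noteq> 0"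
  let ?f = "\<lambda>ns. Rep_vfield (prod_list (map yV ns))"
  have "B_W0 = ?f ` {ns. gap2 ns}" unfolding B_W0_Rep sq.gap_monos_def by blast
  with t(2) have "t \<subseteq> ?f ` {ns. gap2 ns}" by simp
  \<comment> \<open>Different lists could a priori give the same operator, so one list is chosen for
    each member of \<open>t\<close>.\<close>
  then obtain S where S: "S \<subseteq> {ns. gap2 ns}" "inj_on ?f S" "t = ?f ` S"
    unfolding subset_image_inj by (elim exE conjE)
  have fin: "finite S" using t(1) finite_imageD[OF _ S(2)] unfolding S(3) by simp
  have ev: "(sum g I) v $$ n = (\<Sum>i\<in>I. g i v $$ n)" for g :: "oper \<Rightarrow> oper" and I v n
    by (induction I rule: infinite_finite_induct) simp_all
  \<comment> \<open>Apply the relation to the vector 1 and take the constant coefficient in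
    \<open>z\<close>.\<close>
  have "0 = (\<Sum>v\<in>t. scaleH (u v) v) 1 $$ 0" unfolding sum by simp
  also have "\<dots> = (\<Sum>v\<in>t. cst (u v) * v 1 $$ 0)" by (simp add: ev scaleH_nth_cst)
  also have "\<dots> = (\<Sum>ns\<in>S. cst (u (?f ns)) * Xvec ns)"
    unfolding S(3) by (simp add: sum.reindex[OF S(2)] prod_yV_mode_0)
  finally have "(\<Sum>ns\<in>S. cst (u (?f ns)) * Xvec ns) = 0" by simp
  then have "u (?f ns) = 0" if "ns \<in> S" for ns
    using Xvec_independent[OF fin, of "\<lambda>ns. u (?f ns)" ns] S(1) that by auto
  then show False using b S(3) by auto
qed

theorem theorem2p14:
  shows "hom.independent B_W0 \<and> hom.span B_W0 = W0"
  using independent_B_W0 span_B_W0 by blast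

end
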